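(* Let $n\geq 3$. The function $J\colon\mathcal{E}_n\to[0,\infty)$ that records collar radius of equidistant $n$-gons is symmetric and continuous on $\mathcal{E}_n$ and smooth on its interior. If $d_{i_0}$ is maximal among the $d_i$ then, at points $\mathbf{d}=(d_0,\ldots,d_{n-1})$ of the interior, with $J=J(\mathbf{d})$, $$\frac{\partial J}{\partial d_i}(\mathbf{d})=\frac12\,\frac{\pm\cosh(d_i/2)\coth J\sqrt{\frac{\cosh^2J+\sinh^2(d_{i_0}/2)}{\cosh^2J+\sinh^2(d_i/2)}}}{\sinh(d_{i_0}/2)-\sum_{j\neq i_0}\sinh(d_j/2)\sqrt{\frac{\cosh^2J+\sinh^2(d_{i_0}/2)}{\cosh^2J+\sinh^2(d_j/2)}}},$$ where the "$\pm$" is "$+$" for $i=i_0$ and "$-$" otherwise. Values of $J$ approach infinity on sequences in $\mathcal{E}_n$ approaching $\mathcal{HC}_n$, and $J(d_0,\ldots,d_{n-1})=0$ if and only if $d_{i_0}=\sum_{i\neq i_0}d_i$ for some $i_0$.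
   Context: Define $$\mathcal{E}_n=\Big\{(d_0,\ldots,d_{n-1})\in(0,\infty)^n : \sinh(d_{i_0}/2)>\sum_{i\neq i_0}\sinh(d_i/2)\text{ but } d_{i_0}\leq\sum_{i\neq i_0}d_i,\text{ for some } i_0\Big\},$$ $$\mathcal{HC}_n=\Big\{(d_0,\ldots,d_{n-1})\in(0,\infty)^n : \sinh(d_{i_0}/2)=\sum_{i\neq i_0}\sinh(d_i/2),\text{ where } d_{i_0}=\max_i d_i\Big\}.$$ The interior of $\mathcal{E}_n$ is taken in $(0,\infty)^n$. For $J\geq0$ the $J$-equidistant locus to a geodesic $\gamma$ in the hyperbolic plane $\mathbb{H}^2$ is the set of points at distance $J$ from $\gamma$. A set $\{x_0,\ldots,x_{n-1}\}$ of distinct points on a component $C$ of this locus is an equidistant $n$-gon if for some $i_0$ the sequence $x_{i_0},\ldots,x_{n-1},x_0,\ldots,x_{i_0-1}$ is linearly ordered on $C$: in the orientation that $C$ inherits as a boundary component of the region it bounds with $\gamma$, the compact arc of $C$ bounded by $x_{i-1}$ and $x_i$ points from $x_{i-1}$ to $x_i$ for each $i\neq i_0$ (indices mod $n$). Its collar radius is $J$, the distance from the $x_i$ to $\gamma$, and its side length collection is $(d_0,\ldots,d_{n-1})$ with $d_i=\mathrm{dist}(x_{i-1},x_i)$ for $i>0$ and $d_0=\mathrm{dist}(x_{n-1},x_0)$. The set $\mathcal{E}_n$ is exactly the set of side length collections of equidistant $n$-gons, and an equidistant $n$-gon is determined up to isometry by its side length collection, so collar radius is a well-defined function $J$ on $\mathcal{E}_n$.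 *)

theory Defs
  imports "HOL-Analysis.Analysis"
begin

section \<open>The hyperbolic plane\<close>

text \<open>
  The upper half-plane model. The hyperbolic metric induces the Euclidean topology on the
  half-plane, so components and frontiers below are the ones of the library for \<open>complex\<close>.
\<close>

definition hplane :: "complex set" where
  "hplane = {z. 0 < Im z}"

definition hdist :: "complex \<Rightarrow> complex \<Rightarrow> real" where
  "hdist z w = arcosh (1 + (cmod (z - w))\<^sup>2 / (2 * Im z * Im w))"

definition hdist_set :: "complex \<Rightarrow> complex set \<Rightarrow> real" where
  "hdist_set z A = (INF w\<in>A. hdist z w)"

text \<open>Geodesics are complete, i.e. isometrically embedded real lines.\<close>

definition hgeodesic :: "complex set \<Rightarrow> bool" where
  "hgeodesic \<gamma> \<longleftrightarrow>
     (\<exists>g :: real \<Rightarrow> complex. range g = \<gamma> \<and> \<gamma> \<subseteq> hplane \<and> (\<forall>s t. hdist (g s) (g t) = \<bar>s - t\<bar>))"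

definition equidistant_locus :: "real \<Rightarrow> complex set \<Rightarrow> complex set" where
  "equidistant_locus J \<gamma> = {z \<in> hplane. hdist_set z \<gamma> = J}"


section \<open>Equidistant polygons\<close>

text \<open>
  The region bounded by \<open>\<gamma>\<close> and a component \<open>C\<close> of an equidistant locus of \<open>\<gamma>\<close>. If \<open>C = \<gamma>\<close>
  (that is, \<open>J = 0\<close>), where the phrase is degenerate, both sides of \<open>\<gamma>\<close> qualify, so that either
  orientation of \<open>C\<close> is admitted below.
\<close>

definition bounded_region :: "complex set \<Rightarrow> complex set \<Rightarrow> complex set \<Rightarrow> bool" where
  "bounded_region \<gamma> C R \<longleftrightarrow>
     R \<in> components (hplane - (\<gamma> \<union> C)) \<and> frontier R \<inter> hplane = \<gamma> \<union> C"

text \<open>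
  A regular parametrization \<open>c\<close> of \<open>C\<close> has the boundary orientation with respect to \<open>R\<close> when \<open>R\<close>
  lies to the left of \<open>c\<close>: the velocity \<open>v\<close> turned counterclockwise by a right angle, \<open>\<i> * v\<close>,
  points into \<open>R\<close>.
\<close>

definition boundary_param :: "complex set \<Rightarrow> complex set \<Rightarrow> (real \<Rightarrow> complex) \<Rightarrow> bool" where
  "boundary_param R C c \<longleftrightarrow> bij_betw c UNIV C \<and>
     (\<forall>t. \<exists>v. v \<noteq> 0 \<and> (c has_vector_derivative v) (at t) \<and>
        (\<forall>\<^sub>F e in at_right 0. c t + of_real e * (\<i> * v) \<in> R))"

text \<open>
  The vertices are \<open>x 0, \<dots>, x (n - 1)\<close>, and \<open>(i + n - 1) mod n\<close> is the index \<open>i - 1\<close> modulo \<open>n\<close>,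
  written so as to avoid truncated subtraction at \<open>i = 0\<close>.
\<close>

definition equidistant_ngon :: "nat \<Rightarrow> real \<Rightarrow> (nat \<Rightarrow> complex) \<Rightarrow> bool" where
  "equidistant_ngon n J x \<longleftrightarrow> 0 \<le> J \<and>
     (\<exists>\<gamma> C R c. hgeodesic \<gamma> \<and> C \<in> components (equidistant_locus J \<gamma>) \<and>
        bounded_region \<gamma> C R \<and> boundary_param R C c \<and>
        inj_on x {..<n} \<and> x ` {..<n} \<subseteq> C \<and>
        (\<exists>i0<n. \<forall>i<n. i \<noteq> i0 \<longrightarrow> (\<exists>s t. s < t \<and> c s = x ((i + n - 1) mod n) \<and> c t = x i)))"

text \<open>
  Vectors \<open>(d\<^sub>0, \<dots>, d\<^sub>n\<^sub>-\<^sub>1)\<close> are indexed by an arbitrary finite linearly ordered type with \<open>n\<close>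
  elements; \<open>index_nat k\<close> is the position, counted from 0, of \<open>k\<close> in this order.
\<close>

definition index_nat :: "'n::{finite,linorder} \<Rightarrow> nat" where
  "index_nat k = card {..<k}"

definition side_lengths :: "(nat \<Rightarrow> complex) \<Rightarrow> real ^ 'n::{finite,linorder}" where
  "side_lengths x =
     (\<chi> k. hdist (x ((index_nat k + CARD('n) - 1) mod CARD('n))) (x (index_nat k)))"

definition collar_radius :: "real ^ 'n::{finite,linorder} \<Rightarrow> real" where
  "collar_radius d = (THE J. \<exists>x. equidistant_ngon CARD('n) J x \<and> side_lengths x = d)"

definition EE :: "(real ^ 'n::{finite,linorder}) set" where
  "EE = {d. (\<forall>i. 0 < d $ i) \<and>
     (\<exists>i0. sinh (d $ i0 / 2) > (\<Sum>i\<in>UNIV - {i0}. sinh (d $ i / 2)) \<and>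
           d $ i0 \<le> (\<Sum>i\<in>UNIV - {i0}. d $ i))}"

definition HC :: "(real ^ 'n::{finite,linorder}) set" where
  "HC = {d. (\<forall>i. 0 < d $ i) \<and>
     (\<exists>i0. d $ i0 = Max (range (\<lambda>i. d $ i)) \<and>
           sinh (d $ i0 / 2) = (\<Sum>i\<in>UNIV - {i0}. sinh (d $ i / 2)))}"


section \<open>Smoothness\<close>

text \<open>\<open>k\<close> times continuously differentiable; meant for open \<open>S\<close>.\<close>

primrec Ck_on :: "nat \<Rightarrow> 'a::euclidean_space set \<Rightarrow> ('a \<Rightarrow> real) \<Rightarrow> bool" where
  "Ck_on 0 S f \<longleftrightarrow> continuous_on S f"
| "Ck_on (Suc k) S f \<longleftrightarrow> (\<forall>x\<in>S. f differentiable (at x)) \<and>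
     (\<forall>v. Ck_on k S (\<lambda>x. frechet_derivative f (at x) v))"

definition smooth_on :: "'a::euclidean_space set \<Rightarrow> ('a \<Rightarrow> real) \<Rightarrow> bool" where
  "smooth_on S f \<longleftrightarrow> (\<forall>k. Ck_on k S f)"

definition coth :: "real \<Rightarrow> real" where
  "coth x = cosh x / sinh x"

end

theory Submission
  imports Defs
begin

text \<open>
  Projecting the vertices of an equidistant polygon to its geodesic turns a side of length \<open>d\<close> into a
  segment of length \<open>2 * arsinh (sinh (d / 2) / cosh J)\<close>, and the longest such segment is the union of
  the others. For given \<open>d\<close> this equation determines \<open>J\<close>: the map \<open>x \<mapsto> arsinh (c * sinh x)\<close>, which
  compares the segments for two values of \<open>J\<close>, is strictly subadditive for \<open>c > 1\<close>, so the difference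
  of the two sides of the equation is negative below the solution and positive above it. Continuity
  and the behaviour near \<open>HC\<close> follow from this change of sign. Strict subadditivity of \<open>tanh\<close> shows
  that the derivative of the equation in \<open>J\<close> does not vanish at a solution with \<open>J > 0\<close>, so implicit
  differentiation gives the partial derivatives; they are smooth expressions in \<open>d\<close> and \<open>J\<close>, which
  gives smoothness by induction.
\<close>

section \<open>The closing equation\<close>

text \<open>The inequalities that define \<open>EE\<close> are the signs of \<open>closing\<close>
  at the two ends of the range of radii. At radius 0 its value is half the excess of
  \<open>d $ i0\<close> over the other sides, so it is at most 0. For large \<open>j\<close> it
  behaves like the excess of \<open>sinh (d $ i0 / 2)\<close> over the other hyperbolic sines,
  divided by \<open>cosh j\<close>, so it is positive. At \<open>HC\<close> this second excess
  degenerates to 0.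

  \<open>collar_radius\<close> is a definite description over polygons on arbitrary geodesics, so
  equation and polygons must be linked both ways: every polygon satisfies the equation for some
  index, and every solution is realised over the imaginary axis. The index is recovered because a
  zero of \<open>closing\<close> makes its side the strictly longest one.

  Differentiation cannot give continuity on all of \<open>EE\<close>: the derivative in
  \<open>j\<close> carries the factor \<open>tanh j\<close>, which vanishes at collar radius 0, and
  such points belong to \<open>EE\<close>. Hence continuity rests on the change of sign alone, and
  differentiation is confined to the interior, where the collar radius is positive.\<close>

lemma quotient_strict_antimono:
  fixes f f' :: "real \<Rightarrow> real"
  assumes f0: "f 0 = 0"
    and der: "\<And>x. 0 \<le> x \<Longrightarrow> (f has_field_derivative f' x) (at x)"
    and dec: "\<And>x y. 0 < x \<Longrightarrow> x < y \<Longrightarrow> f' y < f' x"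
    and "0 < x" "x < y"
  shows "f y * x < f x * y"
proof -
  obtain s where s: "0 < s" "s < x" "f x - f 0 = (x - 0) * f' s"
    using MVT2[of 0 x f f'] der \<open>0 < x\<close> by auto
  obtain t where t: "x < t" "t < y" "f y - f x = (y - x) * f' t"
    using MVT2[of x y f f'] der \<open>0 < x\<close> \<open>x < y\<close> by auto
  \<comment> \<open>\<open>f' s\<close> and \<open>f' t\<close> are the slopes of the chords over
    \<open>[0, x]\<close> and \<open>[x, y]\<close>.\<close>
  have "(y - x) * f' t < (y - x) * f' s"
    using dec[of s t] s t \<open>x < y\<close> by (intro mult_strict_left_mono) auto
  then have "x * (f y - f x) < x * ((y - x) * f' s)"
    using t(3) \<open>0 < x\<close> by (simp add: mult_strict_left_mono)
  also have "\<dots> = (y - x) * f x"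
    using s(3) f0 by simp
  finally show ?thesis
    by (simp add: algebra_simps)
qed

text \<open>At least two positive terms are what makes the inequality strict: for a single term both
  sides coincide.\<close>

lemma strictly_subadditive_sum:
  fixes f f' :: "real \<Rightarrow> real" and x :: "'a \<Rightarrow> real"
  assumes f0: "f 0 = 0"
    and der: "\<And>x. 0 \<le> x \<Longrightarrow> (f has_field_derivative f' x) (at x)"
    and dec: "\<And>x y. 0 < x \<Longrightarrow> x < y \<Longrightarrow> f' y < f' x"
    and A: "2 \<le> card A"
    and pos: "\<And>i. i \<in> A \<Longrightarrow> 0 < x i"
  shows "f (\<Sum>i\<in>A. x i) < (\<Sum>i\<in>A. f (x i))"
proof -
  have fin: "finite A" and ne: "A \<noteq> {}"
    using A card.infinite by fastforce+
  define s where "s = (\<Sum>i\<in>A. x i)"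
  have s: "0 < s"
    unfolding s_def using fin ne pos by (rule sum_pos)
  text \<open>Since \<open>f x / x\<close> decreases strictly, the sum is compared with the chord of \<open>f\<close> over \<open>[0, s]\<close>.\<close>
  have less: "f s * x i < f (x i) * s" if i: "i \<in> A" for i
  proof -
    have "A - {i} \<noteq> {}"
    proof
      assume "A - {i} = {}"
      then have "A = {i}" using i by auto
      then show False using A by simp
    qed
    then have "0 < (\<Sum>j\<in>A - {i}. x j)"
      using fin pos by (intro sum_pos) auto
    then have "x i < s"
      unfolding s_def using sum.remove[OF fin i, of x] by simp
    with quotient_strict_antimono[OF f0 der dec] pos[OF i] show ?thesis
      by blast
  qed
  have "f s * s = (\<Sum>i\<in>A. f s * x i)"
    by (simp add: s_def sum_distrib_left)
  also have "\<dots> < (\<Sum>i\<in>A. f (x i) * s)"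
    using fin ne less by (rule sum_strict_mono)
  also have "\<dots> = (\<Sum>i\<in>A. f (x i)) * s"
    by (simp add: sum_distrib_right)
  finally show ?thesis
    using s by (simp add: s_def)
qed

text \<open>Decides the sign of \<open>closing\<close> at a point of \<open>HC\<close>, where the
  arguments of \<open>arsinh\<close> add up exactly.\<close>

lemma arsinh_sum_less:
  fixes x :: "'a \<Rightarrow> real"
  assumes "2 \<le> card A" "\<And>i. i \<in> A \<Longrightarrow> 0 < x i"
  shows "arsinh (\<Sum>i\<in>A. x i) < (\<Sum>i\<in>A. arsinh (x i))"
proof (rule strictly_subadditive_sum[where f' = "\<lambda>x. 1 / sqrt (x\<^sup>2 + 1)"])
  fix x y :: real
  assume "0 < x" "x < y"
  then have "x\<^sup>2 < y\<^sup>2" by (simp add: power_strict_mono)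
  moreover have "0 < x\<^sup>2 + 1" by (simp add: add_nonneg_pos)
  ultimately show "1 / sqrt (y\<^sup>2 + 1) < 1 / sqrt (x\<^sup>2 + 1)"
    by (intro divide_strict_left_mono mult_pos_pos) auto
qed (use assms in \<open>auto intro!: arsinh_real_has_field_derivative\<close>)

lemma tanh_sum_less:
  fixes x :: "'a \<Rightarrow> real"
  assumes "2 \<le> card A" "\<And>i. i \<in> A \<Longrightarrow> 0 < x i"
  shows "tanh (\<Sum>i\<in>A. x i) < (\<Sum>i\<in>A. tanh (x i))"
proof (rule strictly_subadditive_sum[where f' = "\<lambda>x. 1 - (tanh x)\<^sup>2"])
  fix x y :: real
  assume "0 < x" "x < y"
  then have "(tanh x)\<^sup>2 < (tanh y)\<^sup>2"
    by (intro power_strict_mono) auto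
  then show "1 - (tanh y)\<^sup>2 < 1 - (tanh x)\<^sup>2" by simp
qed (use assms in \<open>auto intro!: derivative_eq_intros\<close>)

text \<open>The derivative is \<open>c * sqrt ((1 + s) / (c\<^sup>2 * s + 1))\<close> with
  \<open>s = (sinh x)\<^sup>2\<close>, which decreases in \<open>s\<close> because
  \<open>c > 1\<close>; for \<open>c = 1\<close> the map is the identity.\<close>

lemma arsinh_mult_sinh_sum_less:
  fixes x :: "'a \<Rightarrow> real"
  assumes "2 \<le> card A" "\<And>i. i \<in> A \<Longrightarrow> 0 < x i" and c: "1 < c"
  shows "arsinh (c * sinh (\<Sum>i\<in>A. x i)) < (\<Sum>i\<in>A. arsinh (c * sinh (x i)))"
proof (rule strictly_subadditive_sum[where f = "\<lambda>x. arsinh (c * sinh x)"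
        and f' = "\<lambda>x. 1 / sqrt ((c * sinh x)\<^sup>2 + 1) * (c * cosh x)"])
  fix x y :: real
  assume xy: "0 < x" "x < y"
  define s t where "s = (sinh x)\<^sup>2" and "t = (sinh y)\<^sup>2"
  have st: "0 \<le> s" "s < t"
    using xy by (auto simp: s_def t_def intro!: power_strict_mono)
  have c2: "1 < c\<^sup>2"
    using c by (simp add: one_less_power)
  \<comment> \<open>This product is the difference of the two sides of the cross-multiplied
    comparison that follows.\<close>
  have "0 < (c\<^sup>2 - 1) * (t - s)"
    using c2 st by (intro mult_pos_pos) auto
  then have "(1 + t) * (c\<^sup>2 * s + 1) < (1 + s) * (c\<^sup>2 * t + 1)"
    by (simp add: algebra_simps)
  moreover have "0 < c\<^sup>2 * s + 1" "0 < c\<^sup>2 * t + 1"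
    using st by (auto intro!: add_nonneg_pos)
  ultimately have "(1 + t) / (c\<^sup>2 * t + 1) < (1 + s) / (c\<^sup>2 * s + 1)"
    by (simp add: field_simps)
  then have "c * sqrt ((1 + t) / (c\<^sup>2 * t + 1)) < c * sqrt ((1 + s) / (c\<^sup>2 * s + 1))"
    using c by simp
  moreover have "1 / sqrt ((c * sinh z)\<^sup>2 + 1) * (c * cosh z)
      = c * sqrt ((1 + (sinh z)\<^sup>2) / (c\<^sup>2 * (sinh z)\<^sup>2 + 1))" for z
  proof -
    have "cosh z = sqrt (1 + (sinh z)\<^sup>2)"
      by (rule real_sqrt_unique [symmetric]) (auto simp: cosh_square_eq)
    then show ?thesis
      by (simp add: real_sqrt_divide power_mult_distrib)
  qed
  ultimately show "1 / sqrt ((c * sinh y)\<^sup>2 + 1) * (c * cosh y)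
      < 1 / sqrt ((c * sinh x)\<^sup>2 + 1) * (c * cosh x)"
    by (simp add: s_def t_def)
next
  fix x :: real
  have "((\<lambda>x. c * sinh x) has_field_derivative c * cosh x) (at x)"
    by (auto intro!: derivative_eq_intros)
  then show "((\<lambda>x. arsinh (c * sinh x)) has_field_derivative
      1 / sqrt ((c * sinh x)\<^sup>2 + 1) * (c * cosh x)) (at x)"
    by (rule DERIV_chain2[OF arsinh_real_has_field_derivative])
qed (use assms in auto)

text \<open>
  Two points at distance \<open>d\<close> on the same component of the \<open>j\<close>-equidistant locus have feet on the
  geodesic at distance \<open>2 * arsinh (sinh (d / 2) / cosh j)\<close>. A collection of sides closes up to a
  polygon of collar radius \<open>j\<close> iff the foot distance of the side \<open>i0\<close> is the sum of the others.
\<close>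

definition closing :: "real \<Rightarrow> 'n \<Rightarrow> real ^ 'n::finite \<Rightarrow> real" where
  "closing j i0 d = arsinh (sinh (d $ i0 / 2) / cosh j)
     - (\<Sum>i\<in>UNIV - {i0}. arsinh (sinh (d $ i / 2) / cosh j))"

lemma card_others:
  assumes "3 \<le> CARD('n::finite)"
  shows "2 \<le> card (UNIV - {i0 :: 'n})"
  using assms by simp

text \<open>Let \<open>l i\<close> be half the foot distance of side \<open>i\<close> at radius
  \<open>k\<close>. Passing back to the side and on to radius \<open>j\<close> applies
  \<open>x \<mapsto> arsinh (c * sinh x)\<close> to each \<open>l i\<close>. If the foot segment of
  \<open>i0\<close> is at most the sum of the others at \<open>k\<close>, strict subadditivity makes
  it strictly shorter than the sum at \<open>j\<close>.\<close>

lemma closing_neg_of_larger: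
  fixes d :: "real ^ 'n::finite"
  assumes n: "3 \<le> CARD('n)" and pos: "\<And>i. 0 < d $ i"
    and jk: "0 \<le> j" "j < k" and le: "closing k i0 d \<le> 0"
  shows "closing j i0 d < 0"
proof -
  define c where "c = cosh k / cosh j"
  have c: "1 < c"
    using jk by (simp add: c_def cosh_real_nonneg_less_iff)
  define l where "l i = arsinh (sinh (d $ i / 2) / cosh k)" for i
  have lj: "arsinh (sinh (d $ i / 2) / cosh j) = arsinh (c * sinh (l i))" for i
    by (simp add: l_def c_def)
  have l: "0 < l i" for i
    using pos[of i] by (simp add: l_def)
  have "l i0 \<le> (\<Sum>i\<in>UNIV - {i0}. l i)"
    using le by (simp add: closing_def l_def)
  then have "arsinh (c * sinh (l i0)) \<le> arsinh (c * sinh (\<Sum>i\<in>UNIV - {i0}. l i))"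
    using c by (simp add: flip: not_less)
  also have "\<dots> < (\<Sum>i\<in>UNIV - {i0}. arsinh (c * sinh (l i)))"
    using card_others[OF n] l c by (intro arsinh_mult_sinh_sum_less) auto
  finally show ?thesis
    by (simp add: closing_def lj)
qed

lemma closing_less_0_iff:
  fixes d :: "real ^ 'n::finite"
  assumes "3 \<le> CARD('n)" "\<And>i. 0 < d $ i" "0 \<le> j" "closing j i0 d = 0" "0 \<le> k"
  shows "closing k i0 d < 0 \<longleftrightarrow> k < j"
  using closing_neg_of_larger[of d k j i0] closing_neg_of_larger[of d j k i0] assms
  by (cases k j rule: linorder_cases) force+

lemma closing_eq_0_unique:
  fixes d :: "real ^ 'n::finite"
  assumes "3 \<le> CARD('n)" "\<And>i. 0 < d $ i" "0 \<le> j" "closing j i0 d = 0" "0 \<le> k" "closing k i0 d = 0"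
  shows "k = j"
  using closing_neg_of_larger[of d k j i0] closing_neg_of_larger[of d j k i0] assms
  by (cases k j rule: linorder_cases) force+

text \<open>Strictness comes from a third index, whose term is positive. The family \<open>a\<close>
  is kept general because the lemma serves both the hyperbolic sines of the half sides and the half
  foot distances.\<close>

lemma less_of_dominating:
  fixes a :: "'n::finite \<Rightarrow> real"
  assumes pos: "\<And>i. 0 < a i" and dom: "(\<Sum>i\<in>UNIV - {i0}. a i) \<le> a i0" and ne: "i \<noteq> i0" and n: "3 \<le> CARD('n)"
  shows "a i < a i0"
proof -
  have "card (UNIV - {i0} - {i}) > 0" using n ne by (simp add: card_Diff_subset)
  then have "UNIV - {i0} - {i} \<noteq> {}" by fastforce
  then have "0 < (\<Sum>j\<in>UNIV - {i0} - {i}. a j)"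
    by (intro sum_pos pos) auto
  moreover have "(\<Sum>j\<in>UNIV - {i0}. a j) = a i + (\<Sum>j\<in>UNIV - {i0} - {i}. a j)"
    using ne by (intro sum.remove) auto
  ultimately show ?thesis using dom by linarith
qed

text \<open>The substitution \<open>u = 1 / cosh j\<close> turns large radii into small
  \<open>u > 0\<close>. The resulting function \<open>G\<close> vanishes at 0, and its derivative
  there is the excess assumed to be positive.\<close>

lemma closing_pos_exists:
  fixes d :: "real ^ 'n::finite"
  assumes "(\<Sum>i\<in>UNIV - {i0}. sinh (d $ i / 2)) < sinh (d $ i0 / 2)"
  shows "\<exists>j\<ge>0. 0 < closing j i0 d"
proof -
  define G where "G u = arsinh (sinh (d $ i0 / 2) * u) - (\<Sum>i\<in>UNIV - {i0}. arsinh (sinh (d $ i / 2) * u))" for u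
  have D: "((\<lambda>u. arsinh (a * u)) has_field_derivative a) (at 0)" for a :: real
    using DERIV_chain2[OF arsinh_real_has_field_derivative, of "\<lambda>u. a * u" a 0 UNIV]
    by (auto intro!: derivative_eq_intros)
  have "(G has_field_derivative sinh (d $ i0 / 2) - (\<Sum>i\<in>UNIV - {i0}. sinh (d $ i / 2))) (at 0)"
    unfolding G_def by (intro DERIV_diff DERIV_sum D)
  from DERIV_pos_inc_right[OF this] assms obtain e where e: "0 < e" "\<And>h. 0 < h \<Longrightarrow> h < e \<Longrightarrow> G 0 < G (0 + h)"
    by auto
  \<comment> \<open>The cap at 1 keeps \<open>1 / u\<close> in the range of \<open>cosh\<close>, so
    that \<open>arcosh (1 / u)\<close> is a radius with \<open>cosh\<close> equal to
    \<open>1 / u\<close>.\<close>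
  define u where "u = min (e / 2) 1"
  have u: "0 < u" "u < e" "u \<le> 1"
    using e(1) by (auto simp: u_def)
  have "0 < G u"
    using e(2)[OF u(1,2)] by (simp add: G_def)
  moreover have "closing (arcosh (1 / u)) i0 d = G u"
    using u by (simp add: closing_def G_def)
  moreover have "0 \<le> arcosh (1 / u)"
    using u by simp
  ultimately show ?thesis by auto
qed

lemma closing_0: "closing 0 i0 d = (d $ i0 - (\<Sum>i\<in>UNIV - {i0}. d $ i)) / 2"
  by (simp add: closing_def arsinh_sinh_real diff_divide_distrib sum_divide_distrib)

lemma closing_has_zero:
  fixes d :: "real ^ 'n::finite"
  assumes "(\<Sum>i\<in>UNIV - {i0}. sinh (d $ i / 2)) < sinh (d $ i0 / 2)"
    and "d $ i0 \<le> (\<Sum>i\<in>UNIV - {i0}. d $ i)"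
  shows "\<exists>j\<ge>0. closing j i0 d = 0"
proof -
  obtain k where k: "0 \<le> k" "0 < closing k i0 d"
    using closing_pos_exists[OF assms(1)] by auto
  have "continuous_on {0..k} (\<lambda>j. closing j i0 d)"
    unfolding closing_def by (intro continuous_intros) auto
  then have "\<exists>j. 0 \<le> j \<and> j \<le> k \<and> closing j i0 d = 0"
    using k assms(2) by (intro IVT') (auto simp: closing_0)
  then show ?thesis by auto
qed

section \<open>Geodesics and equidistant loci in the half-plane\<close>

lemma hdist_arg_ge_1:
  "z \<in> hplane \<Longrightarrow> w \<in> hplane \<Longrightarrow> 1 \<le> 1 + (cmod (z - w))\<^sup>2 / (2 * Im z * Im w)"
  by (simp add: hplane_def)

lemma cosh_hdist:
  "z \<in> hplane \<Longrightarrow> w \<in> hplane \<Longrightarrow> cosh (hdist z w) = 1 + (cmod (z - w))\<^sup>2 / (2 * Im z * Im w)"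
  unfolding hdist_def by (rule cosh_arcosh_real) (rule hdist_arg_ge_1)

lemma hdist_nonneg: "z \<in> hplane \<Longrightarrow> w \<in> hplane \<Longrightarrow> 0 \<le> hdist z w"
  unfolding hdist_def by (rule arcosh_nonneg_real) (rule hdist_arg_ge_1)

lemma hdist_eq_0_iff: "z \<in> hplane \<Longrightarrow> w \<in> hplane \<Longrightarrow> hdist z w = 0 \<longleftrightarrow> z = w"
  using arcosh_eq_0_iff_real[OF hdist_arg_ge_1, of z w]
  by (auto simp: hdist_def hplane_def)

text \<open>With \<open>0 < a * d - b * c\<close> these are the Moebius transformations of the
  half-plane. The determinant is not normalised to 1, so that coefficients can be read off from the
  points to be sent to 0 and infinity.\<close>

definition fractional_linear :: "real \<Rightarrow> real \<Rightarrow> real \<Rightarrow> real \<Rightarrow> complex \<Rightarrow> complex" where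
  "fractional_linear a b c d z = (of_real a * z + of_real b) / (of_real c * z + of_real d)"

lemma fractional_linear_denominator:
  assumes "0 < a * d - b * c" "z \<in> hplane"
  shows "of_real c * z + of_real d \<noteq> (0 :: complex)"
proof
  assume "of_real c * z + of_real d = (0 :: complex)"
  then have "c * Re z + d = 0" "c * Im z = 0"
    by (auto simp: complex_eq_iff)
  with assms show False by (auto simp: hplane_def)
qed

lemma Im_fractional_linear:
  "Im (fractional_linear a b c d z) = (a * d - b * c) * Im z / (cmod (of_real c * z + of_real d))\<^sup>2"
  unfolding fractional_linear_def by (simp add: Im_divide cmod_power2 algebra_simps)

lemma Re_fractional_linear:
  "Re (fractional_linear a b c d z) =
    (a * c * (cmod z)\<^sup>2 + (a * d + b * c) * Re z + b * d) / (cmod (of_real c * z + of_real d))\<^sup>2"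
  unfolding fractional_linear_def Re_divide cmod_power2
  by (simp add: algebra_simps power2_eq_square add_divide_distrib [symmetric])

lemma fractional_linear_in_hplane:
  assumes "0 < a * d - b * c" "z \<in> hplane"
  shows "fractional_linear a b c d z \<in> hplane"
  using assms fractional_linear_denominator[OF assms] by (simp add: hplane_def Im_fractional_linear)

text \<open>A difference \<open>z - w\<close> is multiplied by the determinant over
  \<open>p * q\<close>, and imaginary parts by the determinant over the squared moduli of
  \<open>p\<close> and \<open>q\<close>; all these factors cancel in the quotient under
  \<open>arcosh\<close>.\<close>

lemma hdist_fractional_linear:
  assumes D: "0 < a * d - b * c" and z: "z \<in> hplane" and w: "w \<in> hplane"
  shows "hdist (fractional_linear a b c d z) (fractional_linear a b c d w) = hdist z w"
proof -
  define p q where "p = of_real c * z + (of_real d :: complex)" and "q = of_real c * w + (of_real d :: complex)"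
  have pq: "p \<noteq> 0" "q \<noteq> 0"
    using fractional_linear_denominator[OF D z] fractional_linear_denominator[OF D w] by (auto simp: p_def q_def)
  have "fractional_linear a b c d z - fractional_linear a b c d w =
      ((of_real a * z + of_real b) * q - (of_real a * w + of_real b) * p) / (p * q)"
    using pq by (simp add: fractional_linear_def p_def [symmetric] q_def [symmetric] diff_frac_eq)
  also have "(of_real a * z + of_real b) * q - (of_real a * w + of_real b) * p = of_real (a * d - b * c) * (z - w)"
    by (simp add: p_def q_def algebra_simps)
  finally have "(cmod (fractional_linear a b c d z - fractional_linear a b c d w))\<^sup>2 =
      (a * d - b * c)\<^sup>2 * (cmod (z - w))\<^sup>2 / ((cmod p)\<^sup>2 * (cmod q)\<^sup>2)"
    by (simp add: norm_mult norm_divide power_mult_distrib power_divide flip: of_real_mult of_real_diff)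
  moreover have "e\<^sup>2 * n / (2 * (e * y) * (e * y')) = n / (2 * y * y')" if "e \<noteq> 0" for e n y y' :: real
    using that by (simp add: power2_eq_square)
  from this[of "a * d - b * c"]
  have "(a * d - b * c)\<^sup>2 * n / (2 * ((a * d - b * c) * y) * ((a * d - b * c) * y')) = n / (2 * y * y')" for n y y'
    using D by simp
  ultimately show ?thesis
    unfolding hdist_def Im_fractional_linear p_def [symmetric] q_def [symmetric]
    using pq by simp
qed

lemma continuous_on_fractional_linear:
  assumes "0 < a * d - b * c"
  shows "continuous_on hplane (fractional_linear a b c d)"
  unfolding fractional_linear_def[abs_def] using fractional_linear_denominator[OF assms]
  by (auto intro!: continuous_intros)

section \<open>Moving a geodesic to the imaginary axis\<close>

definition haxis :: "complex set" where
  "haxis = {z. Re z = 0 \<and> 0 < Im z}"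

lemma fractional_linear_to_axis_exists:
  assumes "p \<in> hplane" "q \<in> hplane"
  shows "\<exists>a b c d. 0 < a * d - b * c \<and> fractional_linear a b c d p \<in> haxis \<and> fractional_linear a b c d q \<in> haxis"
proof (cases "Re p = Re q")
  case True
  then show ?thesis
    using assms
    by (intro exI[of _ 1] exI[of _ "- Re p"] exI[of _ 0])
       (simp add: haxis_def Re_fractional_linear Im_fractional_linear hplane_def)
next
  case False
  text \<open>The geodesic through \<open>p\<close> and \<open>q\<close> is the half circle of centre \<open>m\<close> and radius \<open>r\<close>.\<close>
  define m where "m = ((cmod p)\<^sup>2 - (cmod q)\<^sup>2) / (2 * (Re p - Re q))"
  define r where "r = sqrt ((cmod p)\<^sup>2 - 2 * m * Re p + m\<^sup>2)"
  have sq: "(cmod z)\<^sup>2 - 2 * m * Re z + m\<^sup>2 = (Re z - m)\<^sup>2 + (Im z)\<^sup>2" for z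
    unfolding cmod_power2 by (simp add: power2_eq_square algebra_simps)
  have "0 < (Re p - m)\<^sup>2 + (Im p)\<^sup>2"
    using assms by (intro add_nonneg_pos) (auto simp: hplane_def)
  then have r: "0 < r" "r\<^sup>2 = (cmod p)\<^sup>2 - 2 * m * Re p + m\<^sup>2"
    unfolding r_def sq by simp_all
  have "2 * m * (Re p - Re q) = (cmod p)\<^sup>2 - (cmod q)\<^sup>2"
  proof -
    define k where "k = Re p - Re q"
    have "k \<noteq> 0" using False by (simp add: k_def)
    then show ?thesis by (simp add: m_def flip: k_def)
  qed
  then have "r\<^sup>2 = (cmod q)\<^sup>2 - 2 * m * Re q + m\<^sup>2"
    using r by (simp add: algebra_simps)
  \<comment> \<open>These coefficients send the endpoints \<open>m - r\<close> and
    \<open>m + r\<close> of the half circle to 0 and infinity, with determinant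
    \<open>2 * r\<close>.\<close>
  with r have "Re (fractional_linear 1 (r - m) (- 1) (m + r) p) = 0" "Re (fractional_linear 1 (r - m) (- 1) (m + r) q) = 0"
    unfolding Re_fractional_linear by (simp_all add: algebra_simps power2_eq_square)
  moreover have D: "0 < 1 * (m + r) - (r - m) * (- 1)"
    using r by simp
  ultimately show ?thesis
    using fractional_linear_in_hplane[OF D] assms
    by (intro exI[of _ 1] exI[of _ "r - m"] exI[of _ "- 1"] exI[of _ "m + r"])
       (simp add: haxis_def hplane_def)
qed

lemma haxis_subset: "haxis \<subseteq> hplane"
  by (auto simp: haxis_def hplane_def)

text \<open>The distances of \<open>g t\<close> to the two points \<open>g 0\<close> and \<open>g 1\<close> of the axis determine \<open>g t\<close>.\<close>

lemma range_isometry_axis: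
  fixes g :: "real \<Rightarrow> complex"
  assumes g: "\<And>t. g t \<in> hplane" "\<And>s t. hdist (g s) (g t) = \<bar>s - t\<bar>"
    and ax: "g 0 \<in> haxis" "g 1 \<in> haxis"
  shows "range g = haxis"
proof -
  define A B where "A = Im (g 0)" and "B = Im (g 1)"
  have AB: "0 < A" "0 < B"
    using ax by (auto simp: A_def B_def haxis_def)
  have dist: "(Re (g t))\<^sup>2 + (Im (g t))\<^sup>2 + y\<^sup>2 = 2 * y * Im (g t) * cosh (t - s)"
    if "g s \<in> haxis" "y = Im (g s)" for s t y
  proof -
    have pos: "0 < Im (g t)" "0 < y" using g(1)[of t] g(1)[of s] that by (auto simp: hplane_def)
    have "cosh (t - s) = 1 + (cmod (g t - g s))\<^sup>2 / (2 * Im (g t) * Im (g s))"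
      using cosh_hdist[OF g(1) g(1), of t s] by (simp add: g(2))
    moreover have "(cmod (g t - g s))\<^sup>2 = (Re (g t))\<^sup>2 + (Im (g t) - y)\<^sup>2"
      using that by (simp add: cmod_power2 haxis_def)
    ultimately show ?thesis
      using pos that(2) by (simp add: field_simps power2_eq_square)
  qed
  \<comment> \<open>Distance 1 between \<open>g 0\<close> and \<open>g 1\<close> leaves only the
    ratios \<open>exp 1\<close> and \<open>exp (- 1)\<close>; \<open>\<sigma>\<close> records
    whether \<open>g\<close> runs up or down the axis.\<close>
  define e where "e = B / A"
  have e0: "0 < e" and B_eq: "B = A * e"
    using AB by (auto simp: e_def)
  have "B\<^sup>2 + A\<^sup>2 = 2 * A * B * cosh 1"
    using dist[OF ax(1) A_def, of 1] ax by (simp add: B_def haxis_def)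
  then have "A\<^sup>2 * (e\<^sup>2 + 1) = A\<^sup>2 * (2 * e * cosh 1)"
    by (simp add: B_eq power2_eq_square algebra_simps)
  then have "e\<^sup>2 + 1 = 2 * e * cosh 1"
    using AB by simp
  also have "\<dots> = e * (exp 1 + exp (- 1))"
    by (simp add: cosh_field_def)
  finally have "(e - exp 1) * (e - exp (- 1)) = 0"
    by (simp add: power2_eq_square algebra_simps flip: exp_add)
  then obtain \<sigma> :: real where \<sigma>: "\<sigma> = 1 \<or> \<sigma> = - 1" "e = exp \<sigma>"
    by auto
  have e2: "e\<^sup>2 \<noteq> 1"
    using \<sigma> by (auto simp flip: exp_double)
  have ch: "cosh s = (exp (\<sigma> * s) + 1 / exp (\<sigma> * s)) / 2" for s
    using \<sigma>(1) by (auto simp: cosh_field_def exp_minus field_simps)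
  have g_eq: "Re (g t) = 0 \<and> Im (g t) = A * exp (\<sigma> * t)" for t
  proof -
    define E where "E = exp (\<sigma> * t)"
    define X y where "X = (Re (g t))\<^sup>2 + (Im (g t))\<^sup>2" and "y = Im (g t)"
    have E: "0 < E" by (simp add: E_def)
    have "X + A\<^sup>2 = 2 * A * y * cosh t"
      using dist[OF ax(1) A_def, of t] by (simp add: X_def y_def)
    then have 1: "X + A\<^sup>2 = A * y * (E + 1 / E)"
      by (simp add: ch E_def)
    have "X + B\<^sup>2 = 2 * B * y * cosh (t - 1)"
      using dist[OF ax(2) B_def, of t] by (simp add: X_def y_def)
    moreover have "exp (\<sigma> * (t - 1)) = E / e"
      by (simp add: E_def \<sigma>(2) right_diff_distrib exp_diff)
    ultimately have "X + A\<^sup>2 * e\<^sup>2 = A * e * y * (E / e + e / E)"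
      by (simp only: ch B_eq power_mult_distrib) simp
    also have "\<dots> = A * y * (e * (E / e + e / E))"
      by simp
    also have "e * (E / e + e / E) = E + e\<^sup>2 / E"
      using e0 by (simp add: distrib_left power2_eq_square)
    finally have 2: "X + A\<^sup>2 * e\<^sup>2 = A * y * (E + e\<^sup>2 / E)" .
    \<comment> \<open>Subtracting the two distance equations, multiplied by \<open>E\<close>,
      eliminates \<open>X\<close> and leaves a linear equation for \<open>y\<close>.\<close>
    have "A * (e\<^sup>2 - 1) * (A * E) = A * (e\<^sup>2 - 1) * y"
    proof -
      have "E * (X + A\<^sup>2) = A * y * (E\<^sup>2 + 1)" "E * (X + A\<^sup>2 * e\<^sup>2) = A * y * (E\<^sup>2 + e\<^sup>2)"
        unfolding 1 2 using E by (simp_all add: field_simps power2_eq_square)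
      moreover have "A * (e\<^sup>2 - 1) * (A * E) - A * (e\<^sup>2 - 1) * y =
          (E * (X + A\<^sup>2 * e\<^sup>2) - E * (X + A\<^sup>2)) - (A * y * (E\<^sup>2 + e\<^sup>2) - A * y * (E\<^sup>2 + 1))"
        by (simp add: algebra_simps power2_eq_square)
      ultimately show ?thesis by linarith
    qed
    then have y: "y = A * E"
      using AB e2 by simp
    \<comment> \<open>As \<open>X\<close> is the sum of the squares of \<open>Re (g t)\<close> and
      \<open>y\<close>, this puts \<open>g t\<close> on the axis.\<close>
    have "X = y\<^sup>2"
      using 1 E by (simp add: y field_simps power2_eq_square)
    then show ?thesis
      using y by (simp add: X_def y_def E_def)
  qed
  show ?thesis
  proof (intro equalityI subsetI)
    fix z assume "z \<in> haxis"
    then have "z = g (\<sigma> * ln (Im z / A))"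
      using AB \<sigma>(1) by (intro complex_eqI) (auto simp: g_eq haxis_def simp flip: mult.assoc)
    then show "z \<in> range g" by blast
  qed (use g_eq AB in \<open>auto simp: haxis_def\<close>)
qed

text \<open>It is enough to send two points of the geodesic to the axis: by
  \<open>range_isometry_axis\<close> the whole isometric line then fills the axis.\<close>

lemma hgeodesic_to_axis:
  assumes "hgeodesic \<gamma>"
  shows "\<exists>T. continuous_on hplane T \<and> T ` hplane \<subseteq> hplane \<and>
    (\<forall>z\<in>hplane. \<forall>w\<in>hplane. hdist (T z) (T w) = hdist z w) \<and> T ` \<gamma> = haxis"
proof -
  obtain g :: "real \<Rightarrow> complex" where g: "range g = \<gamma>" "\<gamma> \<subseteq> hplane" "\<And>s t. hdist (g s) (g t) = \<bar>s - t\<bar>"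
    using assms by (auto simp: hgeodesic_def)
  have gh: "g t \<in> hplane" for t using g by auto
  obtain a b c d where D: "0 < a * d - b * c"
    and ax: "fractional_linear a b c d (g 0) \<in> haxis" "fractional_linear a b c d (g 1) \<in> haxis"
    using fractional_linear_to_axis_exists[OF gh gh] by blast
  have "range (\<lambda>t. fractional_linear a b c d (g t)) = haxis"
    by (rule range_isometry_axis) (use ax gh g(3) D in \<open>auto simp: hdist_fractional_linear fractional_linear_in_hplane\<close>)
  then have "fractional_linear a b c d ` \<gamma> = haxis"
    by (auto simp flip: g(1))
  then show ?thesis
    using D by (intro exI[of _ "fractional_linear a b c d"])
      (auto simp: hdist_fractional_linear fractional_linear_in_hplane intro: continuous_on_fractional_linear)
qed

section \<open>Equidistant loci of the imaginary axis\<close>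

lemma hdist_set_haxis:
  assumes z: "z \<in> hplane"
  shows "hdist_set z haxis = arcosh (cmod z / Im z)"
  unfolding hdist_set_def
proof (rule cInf_eq_minimum)
  have y: "0 < Im z" and "z \<noteq> 0" using z by (auto simp: hplane_def)
  have arg: "1 + (cmod (z - w))\<^sup>2 / (2 * Im z * Im w) = ((cmod z)\<^sup>2 + (Im w)\<^sup>2) / (2 * Im z * Im w)"
    if "w \<in> haxis" for w
    using that y unfolding cmod_power2 by (simp add: haxis_def field_simps power2_eq_square)
  \<comment> \<open>The foot of the perpendicular from \<open>z\<close>: the half circle of radius
    \<open>cmod z\<close> about 0 is the geodesic through \<open>z\<close> orthogonal to the
    axis.\<close>
  let ?w = "Complex 0 (cmod z)"
  have w: "?w \<in> haxis" using \<open>z \<noteq> 0\<close> by (simp add: haxis_def)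
  have "hdist z ?w = arcosh (cmod z / Im z)"
    unfolding hdist_def arg[OF w] using y \<open>z \<noteq> 0\<close> by (simp add: field_simps power2_eq_square)
  then show "arcosh (cmod z / Im z) \<in> hdist z ` haxis"
    using w by (metis imageI)
  fix u assume "u \<in> hdist z ` haxis"
  then obtain w where w: "w \<in> haxis" "u = hdist z w" by auto
  have "0 < Im w" using w by (simp add: haxis_def)
  have "1 \<le> cmod z / Im z"
    using y abs_Im_le_cmod[of z] by simp
  \<comment> \<open>The inequality of arithmetic and geometric means for the squares of
    \<open>cmod z\<close> and \<open>Im w\<close>.\<close>
  moreover have "cmod z / Im z \<le> ((cmod z)\<^sup>2 + (Im w)\<^sup>2) / (2 * Im z * Im w)"
    using y \<open>0 < Im w\<close> sum_squares_ge_zero[of "cmod z - Im w" 0]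
    by (simp add: field_simps power2_eq_square)
  ultimately show "arcosh (cmod z / Im z) \<le> u"
    unfolding w(2) hdist_def arg[OF w(1)]
    by (subst not_less [symmetric], subst arcosh_less_iff_real) linarith+
qed

lemma equidistant_locus_haxis:
  assumes "0 \<le> J"
  shows "equidistant_locus J haxis = {z \<in> hplane. cmod z = Im z * cosh J}"
proof -
  have "arcosh (cmod z / Im z) = J \<longleftrightarrow> cmod z = Im z * cosh J" if "z \<in> hplane" for z
  proof -
    have y: "0 < Im z" using that by (auto simp: hplane_def)
    then have "1 \<le> cmod z / Im z"
      using abs_Im_le_cmod[of z] by simp
    then have "arcosh (cmod z / Im z) = J \<longleftrightarrow> cmod z / Im z = cosh J"
      using arcosh_cosh_real[OF assms] cosh_arcosh_real[of "cmod z / Im z"] by auto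
    then show ?thesis using y by (simp add: field_simps)
  qed
  then show ?thesis
    unfolding equidistant_locus_def by (simp add: hdist_set_haxis cong: conj_cong)
qed

lemma connected_same_sign:
  fixes f :: "'a::topological_space \<Rightarrow> real"
  assumes "connected S" "continuous_on S f" "\<And>x. x \<in> S \<Longrightarrow> f x \<noteq> 0" "a \<in> S" "b \<in> S" "0 < f a"
  shows "0 < f b"
proof (rule ccontr)
  assume "\<not> 0 < f b"
  moreover have "connected (f ` S)" using assms by (simp add: connected_continuous_image)
  ultimately have "0 \<in> f ` S"
    using assms connectedD_interval[of "f ` S" "f b" "f a" 0] by auto
  then show False using assms(3) by auto
qed

lemma tanh_cosh_sq: "(tanh x)\<^sup>2 + 1 / (cosh x)\<^sup>2 = (1 :: real)"
  by (simp add: tanh_def power_divide cosh_square_eq add_divide_distrib [symmetric] add.commute)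
    (simp add: add_nonneg_eq_0_iff)

text \<open>The locus at distance \<open>J\<close> of the axis consists of two rays through \<open>0\<close>.\<close>

lemma connected_subset_ray:
  assumes S: "connected S" "S \<subseteq> {z \<in> hplane. cmod z = Im z * cosh J}"
  obtains \<tau> where "\<tau>\<^sup>2 + 1 / (cosh J)\<^sup>2 = 1"
    and "\<And>z. z \<in> S \<Longrightarrow> Re z = cmod z * \<tau> \<and> Im z = cmod z / cosh J"
proof -
  have Im: "Im z = cmod z / cosh J" if "z \<in> S" for z
    using that S by auto
  have sq: "(Re z)\<^sup>2 = (cmod z * tanh J)\<^sup>2" if "z \<in> S" for z
  proof -
    have "(Re z)\<^sup>2 = (cmod z)\<^sup>2 * (1 - 1 / (cosh J)\<^sup>2)"
    proof -
      have "(Re z)\<^sup>2 = (cmod z)\<^sup>2 - (Im z)\<^sup>2"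
        unfolding cmod_power2 by simp
      also have "(Im z)\<^sup>2 = (cmod z)\<^sup>2 / (cosh J)\<^sup>2"
        by (subst Im[OF that]) (rule power_divide)
      finally show ?thesis by (simp add: right_diff_distrib)
    qed
    also have "1 - 1 / (cosh J)\<^sup>2 = (tanh J)\<^sup>2"
      using tanh_cosh_sq[of J] by simp
    finally show ?thesis by (simp add: power_mult_distrib)
  qed
  then have pm: "Re z = cmod z * \<bar>tanh J\<bar> \<or> Re z = - (cmod z * \<bar>tanh J\<bar>)" if "z \<in> S" for z
    using that by (fastforce simp: power2_eq_iff abs_if)
  have nz: "0 < cmod z" if "z \<in> S" for z
    using that S by (auto simp: hplane_def)
  \<comment> \<open>The sign of \<open>Re\<close> could change on a connected set only through 0.
    That value occurs only if \<open>tanh J = 0\<close>, and then both candidates for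
    \<open>\<tau>\<close> coincide.\<close>
  have "\<exists>\<tau>\<in>{\<bar>tanh J\<bar>, - \<bar>tanh J\<bar>}. \<forall>z\<in>S. Re z = cmod z * \<tau>"
  proof (cases "\<exists>a\<in>S. 0 < Re a")
    case True
    then obtain a where a: "a \<in> S" "0 < Re a" by auto
    then have "tanh J \<noteq> 0" using sq[of a] by auto
    then have ne: "Re z \<noteq> 0" if "z \<in> S" for z using sq[OF that] nz[OF that] by auto
    have "Re z = cmod z * \<bar>tanh J\<bar>" if z: "z \<in> S" for z
    proof -
      have "0 < Re z"
        using connected_same_sign[where f = Re, OF S(1) _ ne a(1) z a(2)] by (simp add: continuous_on_Re)
      moreover have "0 \<le> cmod z * \<bar>tanh J\<bar>" by simp
      ultimately show ?thesis using pm[OF z] by linarith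
    qed
    then show ?thesis by auto
  next
    case False
    have "Re z = cmod z * - \<bar>tanh J\<bar>" if z: "z \<in> S" for z
    proof -
      have "Re z \<le> 0" using False z by force
      moreover have "0 \<le> cmod z * \<bar>tanh J\<bar>" by simp
      ultimately show ?thesis
        using pm[OF z] unfolding mult_minus_right by linarith
    qed
    then show ?thesis by auto
  qed
  then obtain \<tau> where "\<tau> \<in> {\<bar>tanh J\<bar>, - \<bar>tanh J\<bar>}" "\<forall>z\<in>S. Re z = cmod z * \<tau>" by blast
  with Im that[of \<tau>] tanh_cosh_sq[of J] show thesis by auto
qed

lemma sinh_half_sq: "(sinh (x / 2))\<^sup>2 = (cosh x - 1) / (2 :: real)"
  using cosh_double[of "x / 2"] by (simp add: cosh_square_eq)

text \<open>The relation between a side and its foot distance that underlies \<open>closing\<close>.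
  The point of modulus \<open>r\<close> has its foot at height \<open>r\<close> on the axis, so the
  feet are \<open>\<bar>ln (cmod z) - ln (cmod w)\<bar>\<close> apart, while the Euclidean distance
  of two points of one ray is the difference of their moduli. The assumption on
  \<open>\<tau>\<close> says that the direction of the ray is a unit vector.\<close>

lemma sinh_half_hdist_ray:
  assumes \<tau>: "\<tau>\<^sup>2 + 1 / (cosh J)\<^sup>2 = 1"
    and z: "z \<noteq> 0" "Re z = cmod z * \<tau>" "Im z = cmod z / cosh J"
    and w: "w \<noteq> 0" "Re w = cmod w * \<tau>" "Im w = cmod w / cosh J"
  shows "sinh (hdist z w / 2) = cosh J * sinh (\<bar>ln (cmod z) - ln (cmod w)\<bar> / 2)"
proof -
  define r s where "r = cmod z" and "s = cmod w"
  have rs: "0 < r" "0 < s"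
    unfolding r_def s_def using z(1) w(1) by simp_all
  have zr: "Re z = r * \<tau>" "Im z = r / cosh J" and ws: "Re w = s * \<tau>" "Im w = s / cosh J"
    unfolding r_def s_def using z(2,3) w(2,3) by blast+
  have mem: "z \<in> hplane" "w \<in> hplane"
    using rs by (simp_all add: hplane_def zr ws)
  have "(cmod (z - w))\<^sup>2 = ((r - s) * \<tau>)\<^sup>2 + ((r - s) / cosh J)\<^sup>2"
    unfolding cmod_power2 by (simp add: zr ws left_diff_distrib diff_divide_distrib)
  also have "\<dots> = (r - s)\<^sup>2 * (\<tau>\<^sup>2 + 1 / (cosh J)\<^sup>2)"
    by (simp add: power_mult_distrib power_divide distrib_left)
  finally have dist: "(cmod (z - w))\<^sup>2 = (r - s)\<^sup>2"
    using \<tau> by simp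
  have "(sinh (hdist z w / 2))\<^sup>2 = (r - s)\<^sup>2 * (cosh J)\<^sup>2 / (4 * r * s)"
    unfolding sinh_half_sq cosh_hdist[OF mem] dist zr(2) ws(2) by (simp add: power2_eq_square)
  moreover have "(sinh (\<bar>ln r - ln s\<bar> / 2))\<^sup>2 = (r - s)\<^sup>2 / (4 * r * s)"
  proof -
    have "cosh (ln r - ln s) = (r / s + s / r) / 2"
      unfolding cosh_field_def using rs by (simp add: exp_diff exp_minus)
    then have "(sinh (\<bar>ln r - ln s\<bar> / 2))\<^sup>2 = ((r / s + s / r) / 2 - 1) / 2"
      unfolding sinh_half_sq by simp
    also have "\<dots> = (r - s)\<^sup>2 / (4 * r * s)"
      using rs by (simp add: field_simps power2_eq_square)
    finally show ?thesis .
  qed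
  ultimately have sq: "(sinh (hdist z w / 2))\<^sup>2 = (cosh J * sinh (\<bar>ln r - ln s\<bar> / 2))\<^sup>2"
    by (simp add: power_mult_distrib)
  have "sinh (hdist z w / 2) = cosh J * sinh (\<bar>ln r - ln s\<bar> / 2)"
    using sq by (rule power2_eq_imp_eq) (simp_all add: hdist_nonneg mem)
  then show ?thesis
    by (simp only: r_def s_def)
qed

section \<open>Equidistant polygons\<close>

lemma bij_betw_cyclic_pred: "0 < n \<Longrightarrow> bij_betw (\<lambda>i. (i + n - 1) mod n) {..<n :: nat} {..<n}"
proof (rule bij_betw_byWitness[where f' = "\<lambda>i. (i + 1) mod n"])
  assume n: "0 < n"
  show "\<forall>i\<in>{..<n}. ((i + n - 1) mod n + 1) mod n = i"
  proof
    fix i assume "i \<in> {..<n}"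
    moreover have "((i + n - 1) mod n + 1) mod n = (i + n - 1 + 1) mod n" by (rule mod_add_left_eq)
    ultimately show "((i + n - 1) mod n + 1) mod n = i" using n by simp
  qed
  show "\<forall>i\<in>{..<n}. ((i + 1) mod n + n - 1) mod n = i"
  proof
    fix i assume i: "i \<in> {..<n}"
    show "((i + 1) mod n + n - 1) mod n = i"
      using i n by (cases "i + 1 = n") auto
  qed
qed auto

text \<open>The cyclic predecessor permutes the indices, so all \<open>n\<close> differences add up
  to 0; the one at \<open>i0\<close> moves to the other side with its sign reversed.\<close>

lemma sum_cyclic_differences:
  fixes p :: "nat \<Rightarrow> real"
  assumes i0: "i0 < n"
  shows "(\<Sum>i\<in>{..<n} - {i0}. p i - p ((i + n - 1) mod n)) = p ((i0 + n - 1) mod n) - p i0"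
proof -
  have "(\<Sum>i<n. p ((i + n - 1) mod n)) = (\<Sum>i<n. p i)"
    using sum.reindex_bij_betw[OF bij_betw_cyclic_pred, of n p] i0 by simp
  then have "(\<Sum>i<n. p i - p ((i + n - 1) mod n)) = 0"
    by (simp add: sum_subtractf)
  then show ?thesis
    using sum.remove[of "{..<n}" i0 "\<lambda>i. p i - p ((i + n - 1) mod n)"] i0 by simp
qed

lemma bij_betw_index_nat: "bij_betw (index_nat :: 'n::{finite,linorder} \<Rightarrow> nat) UNIV {..<CARD('n)}"
proof -
  have "index_nat k < index_nat l" if "k < l" for k l :: 'n
    unfolding index_nat_def using that by (intro psubset_card_mono) auto
  then have inj: "inj (index_nat :: 'n \<Rightarrow> nat)"
    by (intro injI) (metis less_irrefl linorder_neqE)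
  have "index_nat k < CARD('n)" for k :: 'n
    unfolding index_nat_def by (intro psubset_card_mono) auto
  then have "range (index_nat :: 'n \<Rightarrow> nat) \<subseteq> {..<CARD('n)}" by auto
  moreover have "card (range (index_nat :: 'n \<Rightarrow> nat)) = CARD('n)"
    using inj by (rule card_image)
  ultimately have "range (index_nat :: 'n \<Rightarrow> nat) = {..<CARD('n)}"
    by (intro card_subset_eq) auto
  then show ?thesis using inj by (simp add: bij_betw_def)
qed

lemma sum_others_index_nat:
  fixes f :: "nat \<Rightarrow> real" and k0 :: "'n::{finite,linorder}"
  shows "(\<Sum>k\<in>UNIV - {k0}. f (index_nat k)) = (\<Sum>i\<in>{..<CARD('n)} - {index_nat k0}. f i)"
proof (rule sum.reindex_bij_betw)
  have inj: "inj (index_nat :: 'n \<Rightarrow> nat)" and ran: "range (index_nat :: 'n \<Rightarrow> nat) = {..<CARD('n)}"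
    using bij_betw_index_nat[where 'n = 'n] by (simp_all add: bij_betw_def)
  show "bij_betw index_nat (UNIV - {k0}) ({..<CARD('n)} - {index_nat k0})"
    unfolding bij_betw_def image_set_diff[OF inj] ran using inj by (auto intro: inj_on_subset)
qed

text \<open>After the geodesic is moved to the axis, each side is determined by the difference of
  the positions of two feet. The parametrization of \<open>C\<close> orders these positions, so the
  foot segments of all sides but \<open>i0\<close> line up without overlap and telescope to that of
  \<open>i0\<close>.\<close>

lemma closing_of_equidistant_ngon:
  fixes x :: "nat \<Rightarrow> complex"
  assumes "equidistant_ngon CARD('n::{finite,linorder}) J x"
  shows "\<exists>k0 :: 'n. closing J k0 (side_lengths x) = 0"
proof -
  let ?n = "CARD('n)"
  let ?pred = "\<lambda>i. (i + ?n - 1) mod ?n"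
  obtain \<gamma> C R c i0 where J: "0 \<le> J" and \<gamma>: "hgeodesic \<gamma>"
    and C: "C \<in> components (equidistant_locus J \<gamma>)" and c: "boundary_param R C c"
    and x: "x ` {..<?n} \<subseteq> C" and i0: "i0 < ?n"
    and ord: "\<And>i. i < ?n \<Longrightarrow> i \<noteq> i0 \<Longrightarrow> \<exists>s t. s < t \<and> c s = x (?pred i) \<and> c t = x i"
    using assms unfolding equidistant_ngon_def by blast
  obtain T where contT: "continuous_on hplane T" and Th: "T ` hplane \<subseteq> hplane"
    and Tiso: "\<And>z w. z \<in> hplane \<Longrightarrow> w \<in> hplane \<Longrightarrow> hdist (T z) (T w) = hdist z w"
    and T\<gamma>: "T ` \<gamma> = haxis"
    using hgeodesic_to_axis[OF \<gamma>] by blast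
  have \<gamma>h: "\<gamma> \<subseteq> hplane" using \<gamma> by (auto simp: hgeodesic_def)
  have CL: "C \<subseteq> equidistant_locus J \<gamma>" "connected C"
    using C in_components_subset in_components_connected by auto
  then have Ch: "C \<subseteq> hplane" by (auto simp: equidistant_locus_def)
  have "T z \<in> {z \<in> hplane. cmod z = Im z * cosh J}" if "z \<in> C" for z
  proof -
    have z: "z \<in> hplane" "hdist_set z \<gamma> = J"
      using that CL by (auto simp: equidistant_locus_def)
    have "hdist_set (T z) haxis = hdist_set z \<gamma>"
      using z(1) \<gamma>h Tiso unfolding hdist_set_def T\<gamma> [symmetric] image_image
      by (intro arg_cong[where f = Inf] image_cong) auto
    then show ?thesis
      using z Th unfolding equidistant_locus_haxis[OF J, symmetric]
      by (auto simp: equidistant_locus_def)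
  qed
  then have TC: "T ` C \<subseteq> {z \<in> hplane. cmod z = Im z * cosh J}" by auto
  \<comment> \<open>Connectedness confines the image to one of the two rays, so that all vertices
    share one direction \<open>\<tau>\<close>.\<close>
  have "connected (T ` C)"
    using CL(2) contT Ch by (intro connected_continuous_image) (auto intro: continuous_on_subset)
  from connected_subset_ray[OF this TC] obtain \<tau> where \<tau>: "\<tau>\<^sup>2 + 1 / (cosh J)\<^sup>2 = 1"
    and ray: "\<And>z. z \<in> C \<Longrightarrow> Re (T z) = cmod (T z) * \<tau> \<and> Im (T z) = cmod (T z) / cosh J"
    by (metis imageI)
  have nz: "T z \<noteq> 0" if "z \<in> C" for z
    using TC that by (auto simp: hplane_def)
  \<comment> \<open>The arc length coordinate, along the axis, of the foot of
    \<open>T z\<close>.\<close>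
  define p where "p z = ln (cmod (T z))" for z
  have foot: "arsinh (sinh (hdist z w / 2) / cosh J) = \<bar>p z - p w\<bar> / 2" if "z \<in> C" "w \<in> C" for z w
  proof -
    have "sinh (hdist z w / 2) = cosh J * sinh (\<bar>p z - p w\<bar> / 2)"
    proof -
      have "hdist (T z) (T w) = hdist z w"
        using Tiso Ch that by blast
      then show ?thesis
        using sinh_half_hdist_ray[OF \<tau>, of "T z" "T w"] ray[OF that(1)] ray[OF that(2)] nz that
        unfolding p_def by metis
    qed
    then show ?thesis by (simp add: arsinh_sinh_real)
  qed
  have cC: "bij_betw c UNIV C" using c by (simp add: boundary_param_def)
  have contc: "continuous_on UNIV c"
  proof (intro continuous_at_imp_continuous_on ballI)
    fix t
    obtain v where "(c has_vector_derivative v) (at t)"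
      using c unfolding boundary_param_def by blast
    then show "isCont c t" by (rule has_vector_derivative_continuous)
  qed
  have cin: "c t \<in> C" for t using cC by (auto simp: bij_betw_def)
  have "continuous_on UNIV (\<lambda>t. p (c t))"
    unfolding p_def using nz[OF cin] cin Ch contc
    by (intro continuous_intros continuous_on_compose2[OF contT]) auto
  moreover have "inj (\<lambda>t. p (c t))"
  proof (rule injI)
    fix s t assume "p (c s) = p (c t)"
    then have "arsinh (sinh (hdist (c s) (c t) / 2) / cosh J) = 0"
      using foot[OF cin cin, of s t] by simp
    then have "hdist (c s) (c t) = 0" by simp
    then have "c s = c t" using hdist_eq_0_iff cin Ch by blast
    then show "s = t" using cC by (simp add: bij_betw_def inj_eq)
  qed
  ultimately have "strict_mono_on UNIV (\<lambda>t. p (c t)) \<or> strict_antimono_on UNIV (\<lambda>t. p (c t))"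
    using injective_eq_monotone_map[of UNIV "\<lambda>t. p (c t)"] by simp
  \<comment> \<open>\<open>c\<close> may run towards 0 or away from it. Taking \<open>q\<close> to
    be \<open>p\<close> or \<open>- p\<close> makes it increase along \<open>c\<close> without
    changing absolute differences.\<close>
  then obtain q where q: "\<And>s t. s < t \<Longrightarrow> q (c s) < q (c t)" and qp: "\<And>z w. \<bar>q z - q w\<bar> = \<bar>p z - p w\<bar>"
  proof
    assume "strict_antimono_on UNIV (\<lambda>t. p (c t))"
    then show thesis by (intro that[of "\<lambda>z. - p z"]) (auto simp: monotone_on_def)
  qed (rule that, auto simp: monotone_on_def)
  have le: "q (x (?pred i)) \<le> q (x i)" if "i < ?n" "i \<noteq> i0" for i
    using ord[OF that] q less_imp_le by metis
  have xC: "x i \<in> C" "x (?pred i) \<in> C" if "i < ?n" for i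
    using that x by auto
  have "i0 \<in> range (index_nat :: 'n \<Rightarrow> nat)"
    using i0 bij_betw_imp_surj_on[OF bij_betw_index_nat[where 'n = 'n]] by simp
  then obtain k0 :: 'n where k0: "index_nat k0 = i0"
    by auto
  define h where "h i = \<bar>q (x i) - q (x (?pred i))\<bar>" for i
  have idx: "index_nat k < ?n" for k :: 'n
    using bij_betw_index_nat[where 'n = 'n] by (auto simp: bij_betw_def)
  have side: "arsinh (sinh ((side_lengths x :: (real, 'n) vec) $ k / 2) / cosh J) = h (index_nat k) / 2" for k
    using foot[OF xC(2) xC(1), OF idx idx, of k k]
    by (simp add: side_lengths_def h_def qp abs_minus_commute)
  have "(\<Sum>k\<in>UNIV - {k0}. h (index_nat k)) = (\<Sum>i\<in>{..<?n} - {i0}. h i)"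
    by (simp add: sum_others_index_nat k0)
  also have "\<dots> = (\<Sum>i\<in>{..<?n} - {i0}. q (x i) - q (x (?pred i)))"
    using le by (intro sum.cong) (auto simp: h_def)
  also have "\<dots> = q (x (?pred i0)) - q (x i0)"
    using sum_cyclic_differences[OF i0, of "\<lambda>i. q (x i)"] by simp
  \<comment> \<open>The telescoped sum is nonnegative, which settles the absolute value in
    \<open>h i0\<close>.\<close>
  also have "\<dots> = h i0"
  proof -
    have "0 \<le> (\<Sum>i\<in>{..<?n} - {i0}. q (x i) - q (x (?pred i)))"
      using le by (intro sum_nonneg) auto
    then show ?thesis
      using sum_cyclic_differences[OF i0, of "\<lambda>i. q (x i)"] by (simp add: h_def)
  qed
  finally have "closing J k0 (side_lengths x) = 0"
    unfolding closing_def side by (simp add: k0 flip: sum_divide_distrib)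
  then show ?thesis by blast
qed

section \<open>A model ray and the region between it and the axis\<close>

lemma hgeodesic_haxis: "hgeodesic haxis"
  unfolding hgeodesic_def
proof (intro exI[of _ "\<lambda>t. Complex 0 (exp t)"] conjI allI)
  show "range (\<lambda>t. Complex 0 (exp t)) = haxis"
  proof (intro equalityI subsetI)
    fix z assume "z \<in> haxis"
    then have "z = Complex 0 (exp (ln (Im z)))"
      by (auto simp: haxis_def complex_eq_iff)
    then show "z \<in> range (\<lambda>t. Complex 0 (exp t))" by blast
  qed (auto simp: haxis_def)
  show "hdist (Complex 0 (exp s)) (Complex 0 (exp t)) = \<bar>s - t\<bar>" for s t
  proof -
    have "cmod (Complex 0 (exp u)) = exp u" for u by (simp add: cmod_def)
    moreover have "Complex 0 (exp u) \<noteq> 0" for u by (simp add: complex_eq_iff)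
    \<comment> \<open>The axis is itself the ray with \<open>J = 0\<close> and
      \<open>\<tau> = 0\<close>.\<close>
    ultimately show ?thesis
      using sinh_half_hdist_ray[of 0 0 "Complex 0 (exp s)" "Complex 0 (exp t)"] by simp
  qed
qed (rule haxis_subset)

text \<open>The right-hand ray at distance \<open>J\<close> from the axis, along a unit vector. The
  parameter is the arc length position of the foot on the axis, not arc length on the ray.\<close>

definition ray_point :: "real \<Rightarrow> real \<Rightarrow> complex" where
  "ray_point J t = of_real (exp t) * Complex (tanh J) (1 / cosh J)"

lemma ray_point_simps [simp]:
  "Re (ray_point J t) = exp t * tanh J" "Im (ray_point J t) = exp t / cosh J"
  "cmod (ray_point J t) = exp t" "ray_point J t \<noteq> 0" "ray_point J t \<in> hplane"
proof -
  have "cmod (Complex (tanh J) (1 / cosh J)) = 1"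
    using tanh_cosh_sq[of J] by (simp add: cmod_def power_divide)
  then show n: "cmod (ray_point J t) = exp t" by (simp add: ray_point_def norm_mult)
  then show "ray_point J t \<noteq> 0" by auto
qed (auto simp: ray_point_def hplane_def)

lemma sinh_half_hdist_ray_point:
  "sinh (hdist (ray_point J s) (ray_point J t) / 2) = cosh J * sinh (\<bar>s - t\<bar> / 2)"
  using sinh_half_hdist_ray[OF tanh_cosh_sq[of J], of "ray_point J s" "ray_point J t"] by simp

lemma range_ray_point: "range (ray_point J) = {z \<in> hplane. Re z = sinh J * Im z}"
proof (intro equalityI subsetI)
  fix z assume z: "z \<in> {z \<in> hplane. Re z = sinh J * Im z}"
  then have "z = ray_point J (ln (Im z * cosh J))"
    by (intro complex_eqI) (auto simp: hplane_def tanh_def)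
  then show "z \<in> range (ray_point J)" by blast
qed (auto simp: tanh_def)

lemma inj_ray_point: "inj (ray_point J)"
proof (rule injI)
  fix s t assume "ray_point J s = ray_point J t"
  then have "cmod (ray_point J s) = cmod (ray_point J t)" by (rule arg_cong)
  then show "s = t" by simp
qed

lemma continuous_on_ray_point: "continuous_on A (ray_point J)"
  unfolding ray_point_def[abs_def] by (intro continuous_intros)

lemma ray_point_component:
  assumes J: "0 \<le> J"
  shows "range (ray_point J) \<in> components (equidistant_locus J haxis)"
  unfolding in_components_maximal equidistant_locus_haxis[OF J]
proof (intro conjI allI impI)
  show "connected (range (ray_point J))"
    by (intro connected_continuous_image continuous_on_ray_point connected_UNIV)
  fix D assume D: "D \<noteq> {} \<and> range (ray_point J) \<subseteq> D \<and> D \<subseteq> {z \<in> hplane. cmod z = Im z * cosh J} \<and> connected D"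
  then have conn: "connected D" and sub: "D \<subseteq> {z \<in> hplane. cmod z = Im z * cosh J}"
    by blast+
  obtain \<tau> where ray: "\<And>z. z \<in> D \<Longrightarrow> Re z = cmod z * \<tau> \<and> Im z = cmod z / cosh J"
    using connected_subset_ray[OF conn sub] by metis
  \<comment> \<open>One known point of \<open>D\<close> fixes the direction of the ray that contains
    \<open>D\<close>.\<close>
  have "ray_point J 0 \<in> D" using D by blast
  from conjunct1[OF ray[OF this]] have \<tau>: "\<tau> = tanh J" by simp
  have "D \<subseteq> range (ray_point J)"
  proof
    fix z assume z: "z \<in> D"
    have "Re z = cmod z * tanh J" "Im z = cmod z / cosh J"
      using ray[OF z] unfolding \<tau> by blast+
    moreover have "cmod z * tanh J = sinh J * (cmod z / cosh J)"
      by (simp add: tanh_def)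
    ultimately have "Re z = sinh J * Im z"
      by (simp only:)
    then show "z \<in> range (ray_point J)"
      using D z unfolding range_ray_point by blast
  qed
  with D show "D = range (ray_point J)" by blast
qed auto

text \<open>
  In both cases the region lies to the left of the upward oriented ray; for \<open>J = 0\<close> the ray is the
  axis itself.
\<close>

definition sector :: "real \<Rightarrow> complex set" where
  "sector J = (if J = 0 then {z. Re z < 0 \<and> 0 < Im z} else {z. 0 < Re z \<and> Re z < sinh J * Im z})"

lemma sector_subset: "0 \<le> J \<Longrightarrow> sector J \<subseteq> hplane - (haxis \<union> range (ray_point J))"
proof
  fix z assume J: "0 \<le> J" and z: "z \<in> sector J"
  have "0 < Im z"
  proof (cases "J = 0")
    case False
    then have "0 < sinh J * Im z" "0 < sinh J" using J z by (auto simp: sector_def)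
    then show ?thesis by (simp only: zero_less_mult_pos)
  qed (use z in \<open>auto simp: sector_def\<close>)
  then show "z \<in> hplane - (haxis \<union> range (ray_point J))"
    using z unfolding range_ray_point by (auto simp: sector_def hplane_def haxis_def split: if_splits)
qed

lemma in_closure_of_direction:
  assumes "\<forall>\<^sub>F e in at_right 0. z + of_real e * v \<in> R"
  shows "z \<in> closure (R :: complex set)"
proof (rule Lim_in_closed_set[OF closed_closure _ trivial_limit_at_right_real])
  show "\<forall>\<^sub>F e in at_right 0. z + of_real e * v \<in> closure R"
    using assms by (rule eventually_mono) (use closure_subset in blast)
  have "((\<lambda>e. z + of_real e * v) \<longlongrightarrow> z + of_real 0 * v) (at_right 0)"
    by (intro tendsto_intros)
  then show "((\<lambda>e. z + of_real e * v) \<longlongrightarrow> z) (at_right 0)" by simp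
qed

lemma convex_sector: "convex (sector J)"
proof -
  have *: "sector J = (if J = 0 then {z. Re z < 0} \<inter> {z. 0 < Im z} else {z. 0 < Re z} \<inter> {z. inner (Complex 1 (- sinh J)) z < 0})"
    by (auto simp: sector_def inner_complex_def)
  show ?thesis
    unfolding * by (auto intro!: convex_Int convex_halfspace_lt convex_halfspace_Re_lt convex_halfspace_Re_gt convex_halfspace_Im_gt)
qed

lemma open_sector: "open (sector J)"
proof -
  have *: "sector J = (if J = 0 then {z. Re z < 0} \<inter> {z. 0 < Im z} else {z. 0 < Re z} \<inter> {z. Re z < sinh J * Im z})"
    by (auto simp: sector_def)
  show ?thesis
    unfolding * by (auto intro!: open_Int open_Collect_less continuous_intros)
qed

text \<open>On the half-plane, \<open>Re z\<close> and \<open>sinh J * Im z - Re z\<close> vanish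
  only on the removed rays, so neither changes sign on a connected set avoiding them; hence the
  sector is maximal. Each point of the two rays is a limit of points of the sector on the same
  horizontal line.\<close>

lemma bounded_region_sector:
  assumes J: "0 \<le> J"
  shows "bounded_region haxis (range (ray_point J)) (sector J)"
  unfolding bounded_region_def
proof
  have un: "haxis \<union> range (ray_point J) = {z \<in> hplane. Re z = 0 \<or> Re z = sinh J * Im z}"
    unfolding range_ray_point by (auto simp: haxis_def hplane_def)
  define z0 where "z0 = (if J = 0 then Complex (- 1) 1 else Complex (sinh J) 2)"
  have z0: "z0 \<in> sector J" using J by (auto simp: z0_def sector_def)
  show "sector J \<in> components (hplane - (haxis \<union> range (ray_point J)))"
    unfolding in_components_maximal
  proof (intro conjI allI impI sector_subset J convex_connected convex_sector)
    show "sector J \<noteq> {}" using z0 by auto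
    fix D assume D: "D \<noteq> {} \<and> sector J \<subseteq> D \<and> D \<subseteq> hplane - (haxis \<union> range (ray_point J)) \<and> connected D"
    have z0D: "z0 \<in> D" and conn: "connected D" using D z0 by auto
    have nz: "Re z \<noteq> 0" "Re z \<noteq> sinh J * Im z" "0 < Im z" if "z \<in> D" for z
      using D that unfolding un by (auto simp: hplane_def)
    have "D \<subseteq> sector J"
    proof
      fix z assume z: "z \<in> D"
      show "z \<in> sector J"
      proof (cases "J = 0")
        case True
        have "0 < - Re z"
          using connected_same_sign[OF conn _ _ z0D z, of "\<lambda>z. - Re z"] nz True
          by (simp add: z0_def continuous_on_minus continuous_on_Re)
        then show ?thesis using nz[OF z] True by (simp add: sector_def)
      next
        case False
        then have s: "0 < sinh J" using J by simp
        have "0 < Re z"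
          using connected_same_sign[OF conn _ _ z0D z, of Re] nz False s
          by (simp add: z0_def continuous_on_Re)
        moreover have "0 < sinh J * Im z - Re z"
          using connected_same_sign[OF conn _ _ z0D z, of "\<lambda>z. sinh J * Im z - Re z"] nz(2) False s
          by (force simp: z0_def intro!: continuous_intros)
        ultimately show ?thesis using False by (simp add: sector_def)
      qed
    qed
    then show "D = sector J" using D by blast
  qed
  have fr: "frontier (sector J) = closure (sector J) - sector J"
    using open_sector by (simp add: frontier_def interior_open)
  have cl: "closure (sector J) \<subseteq> (if J = 0 then {z. Re z \<le> 0} else {z. 0 \<le> Re z} \<inter> {z. Re z \<le> sinh J * Im z})"
    by (rule closure_minimal) (auto simp: sector_def intro!: closed_Int closed_Collect_le continuous_intros)
  show "frontier (sector J) \<inter> hplane = haxis \<union> range (ray_point J)"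
  proof (intro equalityI subsetI)
    fix z assume "z \<in> frontier (sector J) \<inter> hplane"
    then show "z \<in> haxis \<union> range (ray_point J)"
      using cl unfolding fr un by (auto simp: sector_def hplane_def split: if_splits)
  next
    fix z assume z: "z \<in> haxis \<union> range (ray_point J)"
    then have y: "0 < Im z" and zh: "z \<in> hplane" unfolding un by (auto simp: hplane_def)
    have "z \<in> closure (sector J)"
    proof (cases "J = 0")
      case True
      then have "Re z = 0" using z unfolding un by auto
      then show ?thesis
        using True y by (intro in_closure_of_direction[where v = "- 1"])
          (auto simp: sector_def eventually_at_right_less)
    next
      case False
      then have s: "0 < sinh J * Im z" using J y by simp
      have ev: "\<forall>\<^sub>F e in at_right 0. 0 < e \<and> e < sinh J * Im z"
        unfolding eventually_at_right_field using s by (intro exI[of _ "sinh J * Im z"]) simp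
      from z have "Re z = 0 \<or> Re z = sinh J * Im z" unfolding un by auto
      then show ?thesis
      proof
        assume "Re z = 0"
        then show ?thesis
          using False by (intro in_closure_of_direction[where v = 1] eventually_mono[OF ev])
            (auto simp: sector_def)
      next
        assume "Re z = sinh J * Im z"
        then show ?thesis
          using False by (intro in_closure_of_direction[where v = "- 1"] eventually_mono[OF ev])
            (auto simp: sector_def)
      qed
    qed
    moreover have "z \<notin> sector J" using sector_subset[OF J] z by blast
    ultimately show "z \<in> frontier (sector J) \<inter> hplane" using zh fr by auto
  qed
qed

text \<open>The parametrization is exponential, so its velocity at \<open>t\<close> is the point
  \<open>ray_point J t\<close> itself.\<close>

lemma boundary_param_ray_point:
  assumes J: "0 \<le> J"
  shows "boundary_param (sector J) (range (ray_point J)) (ray_point J)"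
  unfolding boundary_param_def
proof (intro conjI allI)
  show "bij_betw (ray_point J) UNIV (range (ray_point J))"
    by (rule inj_on_imp_bij_betw) (rule inj_ray_point)
  fix t
  have "(ray_point J has_vector_derivative ray_point J t) (at t)"
    unfolding ray_point_def[abs_def] has_vector_derivative_def
    by (auto intro!: derivative_eq_intros simp: scaleR_conv_of_real algebra_simps)
  moreover have "\<forall>\<^sub>F e in at_right 0. ray_point J t + of_real e * (\<i> * ray_point J t) \<in> sector J"
  proof (cases "J = 0")
    case True
    show ?thesis
      using eventually_at_right_less[of 0] by (rule eventually_mono) (simp add: True sector_def)
  next
    case False
    then have s: "0 < sinh J" using J by simp
    then have ev: "\<forall>\<^sub>F e in at_right 0. 0 < e \<and> e < sinh J"
      unfolding eventually_at_right_field by (intro exI[of _ "sinh J"]) simp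
    show ?thesis
    proof (rule eventually_mono[OF ev])
      fix e :: real assume e: "0 < e \<and> e < sinh J"
      let ?z = "ray_point J t + of_real e * (\<i> * ray_point J t)"
      \<comment> \<open>The bound \<open>e < sinh J\<close> is read off here: at
        \<open>e = sinh J\<close> the normal reaches the axis.\<close>
      have "Re ?z = exp t / cosh J * (sinh J - e)" "Im ?z = exp t / cosh J * (1 + e * sinh J)"
        by (simp_all add: tanh_def field_simps)
      moreover have "0 < sinh J * (e * sinh J)"
        using e s by (intro mult_pos_pos) auto
      then have "sinh J - e < sinh J * (1 + e * sinh J)"
        using e by (simp only: distrib_left mult_1_right) linarith
      then have "exp t / cosh J * (sinh J - e) < exp t / cosh J * (sinh J * (1 + e * sinh J))"
        by (intro mult_strict_left_mono) auto
      ultimately show "?z \<in> sector J"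
        using False e by (simp add: sector_def mult_ac)
    qed
  qed
  ultimately show "\<exists>v. v \<noteq> 0 \<and> (ray_point J has_vector_derivative v) (at t) \<and>
      (\<forall>\<^sub>F e in at_right 0. ray_point J t + of_real e * (\<i> * v) \<in> sector J)"
    by (intro exI[of _ "ray_point J t"]) simp
qed

section \<open>Polygons with prescribed sides\<close>

lemma mod_less_double: "m < 2 * n \<Longrightarrow> m mod n = (if m < n then m else m - n)" for m n :: nat
  by (simp add: le_mod_geq)

text \<open>All gaps but the one into \<open>i0\<close> can be prescribed freely: walking once
  around from \<open>i0\<close> gives the positions, and positive gaps keep them distinct.\<close>

lemma cyclic_partial_sums:
  fixes m :: "nat \<Rightarrow> real"
  assumes i0: "i0 < n" and m: "\<And>i. 0 < m i"
  shows "\<exists>s. (\<forall>i<n. i \<noteq> i0 \<longrightarrow> s i = s ((i + n - 1) mod n) + m i) \<and> inj_on s {..<n}"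
proof -
  text \<open>The indices are renumbered from \<open>i0\<close> on; \<open>e i\<close> is the new number of \<open>i\<close>.\<close>
  define e where "e i = (if i0 \<le> i then i - i0 else i + n - i0)" for i
  \<comment> \<open>\<open>m i\<close> is the gap that leads into \<open>i\<close>, hence
    \<open>Suc k\<close>. For \<open>i < n\<close> the number \<open>e i\<close> is less than
    \<open>n\<close>, so \<open>m i0\<close> is never summed.\<close>
  define s where "s i = (\<Sum>k<e i. m ((i0 + Suc k) mod n))" for i
  have e_back: "(i0 + e i) mod n = i" if "i < n" for i
    using that i0 by (simp add: e_def)
  have e_pred: "e i = Suc (e ((i + n - 1) mod n))" if "i < n" "i \<noteq> i0" for i
  proof (cases "i = 0")
    case True
    then show ?thesis using that i0 by (simp add: e_def) linarith
  next
    case False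
    then have "(i + n - 1) mod n = i - 1"
      using that mod_less_double[of "i + n - 1" n] by simp
    then show ?thesis using False that i0 by (simp add: e_def) linarith
  qed
  have step: "s i = s ((i + n - 1) mod n) + m i" if "i < n" "i \<noteq> i0" for i
  proof -
    have "s i = s ((i + n - 1) mod n) + m ((i0 + e i) mod n)"
      unfolding s_def e_pred[OF that] by (rule sum.lessThan_Suc)
    then show ?thesis by (simp only: e_back[OF that(1)])
  qed
  have mono: "s i < s j" if "e i < e j" for i j
    unfolding s_def
  proof (rule sum_strict_mono2[where b = "e i"])
    show "{..<e i} \<subseteq> {..<e j}" "e i \<in> {..<e j} - {..<e i}"
      using that by auto
  qed (simp_all add: m less_imp_le)
  have "inj_on s {..<n}"
  proof (rule inj_onI)
    fix i j assume ij: "i \<in> {..<n}" "j \<in> {..<n}" and "s i = s j"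
    then have "\<not> e i < e j" "\<not> e j < e i"
      using mono[of i j] mono[of j i] by linarith+
    then have "(i0 + e i) mod n = (i0 + e j) mod n" by simp
    then show "i = j" using ij by (simp only: e_back lessThan_iff)
  qed
  with step show ?thesis by (intro exI[of _ s]) simp
qed

text \<open>The vertices are put on the model ray, with their feet spaced by the foot distances
  \<open>l k\<close> that the sides require at radius \<open>J\<close>.\<close>

lemma equidistant_ngon_of_closing:
  fixes d :: "real ^ 'n::{finite,linorder}"
  assumes J: "0 \<le> J" and pos: "\<And>i. 0 < d $ i" and cl: "closing J k0 d = 0"
  shows "\<exists>x. equidistant_ngon CARD('n) J x \<and> side_lengths x = d"
proof -
  let ?n = "CARD('n)"
  let ?pred = "\<lambda>i. (i + ?n - 1) mod ?n"
  have idx: "index_nat k < ?n" for k :: 'n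
    using bij_betw_index_nat[where 'n = 'n] by (auto simp: bij_betw_def)
  define i0 where "i0 = index_nat k0"
  have i0: "i0 < ?n" by (simp add: i0_def idx)
  define l where "l k = 2 * arsinh (sinh (d $ k / 2) / cosh J)" for k
  have l: "0 < l k" for k using pos[of k] by (simp add: l_def)
  have l_sinh: "cosh J * sinh (l k / 2) = sinh (d $ k / 2)" for k by (simp add: l_def)
  define m where "m i = l (inv index_nat i)" for i
  have m_idx: "m (index_nat k) = l k" for k
    using bij_betw_index_nat[where 'n = 'n] by (simp add: m_def bij_betw_def inv_f_f)
  have m: "0 < m i" for i by (simp add: m_def l)
  obtain s where s_step: "\<And>i. i < ?n \<Longrightarrow> i \<noteq> i0 \<Longrightarrow> s i = s (?pred i) + m i" and s_inj: "inj_on s {..<?n}"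
    using cyclic_partial_sums[of i0 ?n m, OF i0 m] by metis
  have gap: "\<bar>s (?pred i) - s i\<bar> = m i" if "i < ?n" for i
  proof (cases "i = i0")
    case True
    have "s (?pred i0) - s i0 = (\<Sum>i\<in>{..<?n} - {i0}. s i - s (?pred i))"
      using sum_cyclic_differences[OF i0, of s] by simp
    also have "\<dots> = (\<Sum>i\<in>{..<?n} - {i0}. m i)"
      using s_step by (intro sum.cong) auto
    also have "\<dots> = (\<Sum>k\<in>UNIV - {k0}. l k)"
      unfolding i0_def by (simp flip: sum_others_index_nat add: m_idx)
    \<comment> \<open>The closing equation enters only here: it gives the remaining gap, from the
      last vertex back to the vertex \<open>i0\<close>, its required length.\<close>
    also have "\<dots> = l k0"
      using cl by (simp add: closing_def l_def flip: sum_distrib_left)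
    finally show ?thesis
      using True l[of k0] m_idx[of k0] by (simp add: i0_def)
  next
    case False
    then show ?thesis using s_step[OF that] m[of i] by simp
  qed
  define x where "x i = ray_point J (s i)" for i
  have "inj_on x {..<?n}"
    using comp_inj_on[OF s_inj inj_on_subset[OF inj_ray_point subset_UNIV]] by (simp add: x_def[abs_def] comp_def)
  moreover have "x ` {..<?n} \<subseteq> range (ray_point J)"
    by (auto simp: x_def)
  moreover have "\<exists>i0<?n. \<forall>i<?n. i \<noteq> i0 \<longrightarrow> (\<exists>u t. u < t \<and> ray_point J u = x (?pred i) \<and> ray_point J t = x i)"
  proof (intro exI[of _ i0] conjI i0 allI impI)
    fix i assume "i < ?n" "i \<noteq> i0"
    then have "s (?pred i) < s i" using s_step[of i] m[of i] by simp
    then show "\<exists>u t. u < t \<and> ray_point J u = x (?pred i) \<and> ray_point J t = x i"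
      unfolding x_def by blast
  qed
  ultimately have "equidistant_ngon ?n J x"
    using J hgeodesic_haxis ray_point_component[OF J] bounded_region_sector[OF J] boundary_param_ray_point[OF J]
    unfolding equidistant_ngon_def by blast
  moreover have "(side_lengths x :: (real, 'n) vec) $ k = d $ k" for k
  proof -
    have "sinh (hdist (x (?pred (index_nat k))) (x (index_nat k)) / 2) = sinh (d $ k / 2)"
      unfolding x_def sinh_half_hdist_ray_point gap[OF idx] m_idx by (rule l_sinh)
    then show ?thesis by (simp add: side_lengths_def)
  qed
  ultimately show ?thesis
    by (metis vec_eq_iff)
qed

section \<open>Smooth functions and implicit differentiation\<close>

lemma Ck_on_continuous: "Ck_on k S f \<Longrightarrow> continuous_on S f"
  using differentiable_imp_continuous_on[OF differentiable_at_imp_differentiable_on, of S f]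
  by (cases k) auto

text \<open>For the product and chain rules, in which \<open>f\<close> itself appears beside its
  derivatives.\<close>

lemma Ck_on_lower: "Ck_on (Suc k) S f \<Longrightarrow> Ck_on k S f"
proof (induction k arbitrary: f)
  case 0
  then show ?case using Ck_on_continuous[of "Suc 0" S f] by simp
next
  case (Suc k)
  then show ?case by (metis Ck_on.simps(2))
qed

lemma Ck_on_cong:
  assumes "open S" "\<And>x. x \<in> S \<Longrightarrow> f x = g x" "Ck_on k S f"
  shows "Ck_on k S g"
  using assms(2,3)
proof (induction k arbitrary: f g)
  case 0
  then show ?case using continuous_on_cong by force
next
  case (Suc k)
  have der: "(g has_derivative frechet_derivative f (at x)) (at x)" if "x \<in> S" for x
  proof (rule has_derivative_transform_within_open[OF _ \<open>open S\<close> that])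
    show "(f has_derivative frechet_derivative f (at x)) (at x)"
      using Suc.prems(2) that frechet_derivative_works by auto
  qed (use Suc.prems in auto)
  then have eq: "frechet_derivative f (at x) = frechet_derivative g (at x)" if "x \<in> S" for x
    using frechet_derivative_at that by blast
  have "Ck_on k S (\<lambda>x. frechet_derivative g (at x) v)" for v
    by (rule Suc.IH[of "\<lambda>x. frechet_derivative f (at x) v"]) (use Suc.prems(2) eq in simp_all)
  then show ?case
    using differentiableI[OF der] by simp
qed

text \<open>\<open>Ck_on\<close> speaks of \<open>frechet_derivative\<close>; by uniqueness of
  derivatives any explicit formula may take its place.\<close>

lemma Ck_on_SucI:
  assumes S: "open S"
    and der: "\<And>x. x \<in> S \<Longrightarrow> (f has_derivative f' x) (at x)"
    and Ck: "\<And>v. Ck_on k S (\<lambda>x. f' x v)"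
  shows "Ck_on (Suc k) S f"
proof -
  have "f' x = frechet_derivative f (at x)" if "x \<in> S" for x
    using frechet_derivative_at der that by blast
  then have "Ck_on k S (\<lambda>x. frechet_derivative f (at x) v)" for v
    using Ck_on_cong[OF S _ Ck[of v], of "\<lambda>x. frechet_derivative f (at x) v"] by simp
  then show ?thesis
    using differentiableI[OF der] by simp
qed

lemma Ck_on_has_derivative:
  "Ck_on (Suc k) S f \<Longrightarrow> x \<in> S \<Longrightarrow> (f has_derivative frechet_derivative f (at x)) (at x)"
  using frechet_derivative_works by auto

lemma Ck_on_const: "open S \<Longrightarrow> Ck_on k S (\<lambda>x. c)"
proof (induction k arbitrary: c)
  case (Suc k)
  then show ?case
    by (intro Ck_on_SucI[where f' = "\<lambda>_ _. 0"] has_derivative_const) simp_all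
qed simp

lemma Ck_on_bounded_linear:
  assumes "open S" "bounded_linear f"
  shows "Ck_on k S f"
proof (cases k)
  case 0
  then show ?thesis
    using assms(2) by (simp add: linear_continuous_on)
next
  case (Suc k)
  then show ?thesis
    unfolding Suc using assms
    by (intro Ck_on_SucI[where f' = "\<lambda>_. f"] Ck_on_const bounded_linear_imp_has_derivative)
qed

lemma Ck_on_add:
  assumes S: "open S"
  shows "Ck_on k S f \<Longrightarrow> Ck_on k S g \<Longrightarrow> Ck_on k S (\<lambda>x. f x + g x)"
proof (induction k arbitrary: f g)
  case 0
  then show ?case by (auto intro: continuous_on_add)
next
  case (Suc k)
  show ?case
  proof (rule Ck_on_SucI[OF S])
    fix x assume "x \<in> S"
    then show "((\<lambda>x. f x + g x) has_derivative
        (\<lambda>v. frechet_derivative f (at x) v + frechet_derivative g (at x) v)) (at x)"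
      using Ck_on_has_derivative[OF Suc.prems(1)] Ck_on_has_derivative[OF Suc.prems(2)]
      by (intro has_derivative_add)
  next
    fix v
    show "Ck_on k S (\<lambda>x. frechet_derivative f (at x) v + frechet_derivative g (at x) v)"
      using Suc.prems by (intro Suc.IH) simp_all
  qed
qed

lemma Ck_on_sum:
  assumes S: "open S"
  shows "finite A \<Longrightarrow> (\<And>i. i \<in> A \<Longrightarrow> Ck_on k S (f i)) \<Longrightarrow> Ck_on k S (\<lambda>x. \<Sum>i\<in>A. f i x)"
  by (induction A rule: finite_induct) (simp_all add: Ck_on_add Ck_on_const S)

lemma Ck_on_mult:
  assumes S: "open S"
  shows "Ck_on k S f \<Longrightarrow> Ck_on k S g \<Longrightarrow> Ck_on k S (\<lambda>x. f x * g x)"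
proof (induction k arbitrary: f g)
  case 0
  then show ?case by (auto intro: continuous_on_mult)
next
  case (Suc k)
  show ?case
  proof (rule Ck_on_SucI[OF S])
    fix x assume "x \<in> S"
    then show "((\<lambda>x. f x * g x) has_derivative
        (\<lambda>v. f x * frechet_derivative g (at x) v + frechet_derivative f (at x) v * g x)) (at x)"
      using Ck_on_has_derivative[OF Suc.prems(1)] Ck_on_has_derivative[OF Suc.prems(2)]
      by (intro has_derivative_mult)
  next
    fix v
    show "Ck_on k S (\<lambda>x. f x * frechet_derivative g (at x) v + frechet_derivative f (at x) v * g x)"
      using Suc.prems Ck_on_lower[of k S f] Ck_on_lower[of k S g]
      by (intro Ck_on_add[OF S] Suc.IH) simp_all
  qed
qed

text \<open>The sequence \<open>\<phi>\<close> lists the iterated derivatives of \<open>\<phi> 0\<close>.\<close>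

lemma Ck_on_compose:
  fixes \<phi> :: "nat \<Rightarrow> real \<Rightarrow> real"
  assumes S: "open S"
    and der: "\<And>m y. y \<in> U \<Longrightarrow> (\<phi> m has_field_derivative \<phi> (Suc m) y) (at y)"
    and fU: "\<And>x. x \<in> S \<Longrightarrow> f x \<in> U"
  shows "Ck_on k S f \<Longrightarrow> Ck_on k S (\<lambda>x. \<phi> m (f x))"
proof (induction k arbitrary: m)
  case 0
  have "continuous_on U (\<phi> m)"
    using der DERIV_isCont by (intro continuous_at_imp_continuous_on) blast
  then show ?case
    using 0 fU by (auto intro: continuous_on_compose2)
next
  case (Suc k)
  show ?case
  proof (rule Ck_on_SucI[OF S])
    fix x assume "x \<in> S"
    then show "((\<lambda>x. \<phi> m (f x)) has_derivative (\<lambda>v. frechet_derivative f (at x) v * \<phi> (Suc m) (f x))) (at x)"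
      by (intro DERIV_compose_FDERIV[OF der] fU Ck_on_has_derivative[OF Suc.prems])
  next
    fix v
    show "Ck_on k S (\<lambda>x. frechet_derivative f (at x) v * \<phi> (Suc m) (f x))"
      using Suc.prems Ck_on_lower[of k S f] by (intro Ck_on_mult[OF S] Suc.IH) simp_all
  qed
qed

lemma Ck_on_cosh:
  assumes "open S" "Ck_on k S f"
  shows "Ck_on k S (\<lambda>x. cosh (f x))"
proof -
  let ?\<phi> = "\<lambda>m :: nat. if even m then cosh else (sinh :: real \<Rightarrow> real)"
  have "Ck_on k S (\<lambda>x. ?\<phi> 0 (f x))"
  proof (rule Ck_on_compose[OF assms(1) _ _ assms(2), of UNIV ?\<phi>])
    fix m and y :: real
    show "(?\<phi> m has_field_derivative ?\<phi> (Suc m) y) (at y)"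
      using has_field_derivative_sinh[OF DERIV_ident, of y] has_field_derivative_cosh[OF DERIV_ident, of y]
      by (cases "even m") simp_all
  qed auto
  then show ?thesis by simp
qed

lemma Ck_on_sinh:
  assumes "open S" "Ck_on k S f"
  shows "Ck_on k S (\<lambda>x. sinh (f x))"
proof -
  let ?\<phi> = "\<lambda>m :: nat. if even m then sinh else (cosh :: real \<Rightarrow> real)"
  have "Ck_on k S (\<lambda>x. ?\<phi> 0 (f x))"
  proof (rule Ck_on_compose[OF assms(1) _ _ assms(2), of UNIV ?\<phi>])
    fix m and y :: real
    show "(?\<phi> m has_field_derivative ?\<phi> (Suc m) y) (at y)"
      using has_field_derivative_sinh[OF DERIV_ident, of y] has_field_derivative_cosh[OF DERIV_ident, of y]
      by (cases "even m") simp_all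
  qed auto
  then show ?thesis by simp
qed

text \<open>One rule for inverse square roots (\<open>a = - 1 / 2\<close>) and reciprocals
  (\<open>a = - 1\<close>); the products in the iterated derivatives are falling factorials of
  \<open>a\<close>.\<close>

lemma Ck_on_powr:
  assumes S: "open S" and f: "Ck_on k S f" and pos: "\<And>x. x \<in> S \<Longrightarrow> 0 < f x"
  shows "Ck_on k S (\<lambda>x. f x powr a)"
proof -
  let ?\<phi> = "\<lambda>m y. (\<Prod>j<m. a - real j) * y powr (a - real m)"
  have "Ck_on k S (\<lambda>x. ?\<phi> 0 (f x))"
  proof (rule Ck_on_compose[OF S _ _ f, of "{0<..}" ?\<phi>])
    fix m and y :: real
    assume "y \<in> {0<..}"
    then have "((\<lambda>y. y powr (a - real m)) has_field_derivative (a - real m) * y powr (a - real m - 1)) (at y)"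
      by (intro has_real_derivative_powr) auto
    from DERIV_cmult[OF this, of "\<Prod>j<m. a - real j"]
    show "(?\<phi> m has_field_derivative ?\<phi> (Suc m) y) (at y)"
      by (simp add: algebra_simps)
  qed (use pos in auto)
  then show ?thesis by simp
qed

text \<open>The interior of \<open>EE\<close> is treated piece by piece, with one open piece for
  each index of a longest side.\<close>

lemma Ck_on_Union:
  assumes "\<And>S. S \<in> \<S> \<Longrightarrow> open S" "\<And>S. S \<in> \<S> \<Longrightarrow> Ck_on k S f"
  shows "Ck_on k (\<Union>\<S>) f"
  using assms(2)
proof (induction k arbitrary: f)
  case 0
  then show ?case
    using continuous_on_open_Union[of \<S> f] assms(1) by simp
next
  case (Suc k)
  then show ?case by (simp only: Ck_on.simps) blast
qed

text \<open>A version of the implicit function theorem in which the solution is already known and continuous.\<close>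

lemma has_derivative_implicit:
  fixes F :: "real \<times> 'a::real_normed_vector \<Rightarrow> real"
  assumes F: "(F has_derivative F') (at (y x, x))"
    and y: "isCont y x"
    and zero: "\<forall>\<^sub>F z in nhds x. F (y z, z) = 0"
    and ne: "F' (1, 0) \<noteq> 0"
  shows "(y has_derivative (\<lambda>v. - F' (0, v) / F' (1, 0))) (at x)"
proof -
  interpret F': bounded_linear F' using F by (rule has_derivative_bounded_linear)
  define c where "c = F' (1, 0)"
  define L where "L v = - F' (0, v) / c" for v
  have "bounded_linear (\<lambda>v. F' (0, v))"
    using F'.bounded_linear_axioms bounded_linear_Pair[OF bounded_linear_zero bounded_linear_ident]
    by (rule bounded_linear_compose)
  then have "bounded_linear (\<lambda>v. F' (0, v) * (- 1 / c))"
    by (rule bounded_linear_mult_const)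
  then have L: "bounded_linear L"
    unfolding L_def by (simp add: field_simps)
  \<comment> \<open>\<open>s = L v\<close> solves the linearised equation, and \<open>F'\<close>
    measures the deviation from it, scaled by \<open>c\<close>.\<close>
  have F'_eq: "F' (s, v) = c * (s - L v)" for s v
  proof -
    have "F' (s, v) = F' (s *\<^sub>R (1, 0) + (0, v))" by simp
    also have "\<dots> = s * c + F' (0, v)" by (simp only: F'.add F'.scaleR c_def real_scaleR_def)
    finally show ?thesis using ne by (simp add: L_def c_def field_simps)
  qed
  obtain B where B: "0 < B" "\<And>v. norm (L v) \<le> norm v * B"
    using bounded_linear.pos_bounded[OF L] by auto
  have "(y has_derivative L) (at x)"
    unfolding has_derivative_at_alt
  proof (intro conjI L allI impI)
    fix e :: real assume "0 < e"
    \<comment> \<open>The bound \<open>1 / 2\<close> lets half of the error be absorbed in the last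
      estimate; the other bound brings the resulting constant \<open>2 * e1 * (B + 1)\<close> below
      \<open>e\<close>.\<close>
    define e1 where "e1 = min (1 / 2) (e / (2 * (B + 1)))"
    have "e1 \<le> 1 / 2" "e1 \<le> e / (2 * (B + 1))"
      unfolding e1_def by linarith+
    moreover have "0 < e1"
      using \<open>0 < e\<close> B(1) by (simp add: e1_def)
    ultimately have e1: "0 < e1" "e1 \<le> 1 / 2" "e1 \<le> e / (2 * (B + 1))"
      by auto
    then have e1': "2 * e1 * (B + 1) \<le> e"
      using B(1) by (simp add: pos_le_divide_eq algebra_simps)
    have "0 < e1 * \<bar>c\<bar>" using e1 ne by (simp add: c_def)
    with F obtain d where d: "0 < d" "\<And>p. norm (p - (y x, x)) < d \<Longrightarrow>
        norm (F p - F (y x, x) - F' (p - (y x, x))) \<le> e1 * \<bar>c\<bar> * norm (p - (y x, x))"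
      unfolding has_derivative_at_alt by metis
    have zx: "F (y x, x) = 0"
      using zero eventually_nhds_x_imp_x by fast
    have "\<forall>\<^sub>F z in nhds x. norm (y z - y x) < d / 2 \<and> norm (z - x) < d / 2"
    proof (intro eventually_conj)
      have "(y \<longlongrightarrow> y x) (nhds x)"
        using y by (simp add: isCont_def tendsto_nhds_iff)
      then show "\<forall>\<^sub>F z in nhds x. norm (y z - y x) < d / 2"
        using tendstoD[of y "y x" "nhds x" "d / 2"] d(1) by (simp add: dist_norm)
      show "\<forall>\<^sub>F z in nhds x. norm (z - x) < d / 2"
        using d(1) by (auto simp: eventually_nhds_metric dist_norm intro!: exI[of _ "d / 2"])
    qed
    with zero have "\<forall>\<^sub>F z in nhds x. norm (y z - y x - L (z - x)) \<le> e * norm (z - x)"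
    proof eventually_elim
      case (elim z)
      define s where "s = y z - y x"
      define v where "v = z - x"
      have nrm: "norm (s, v) \<le> \<bar>s\<bar> + norm v"
        using norm_Pair_le[of s v] by simp
      then have "norm ((y z, z) - (y x, x)) < d"
        using elim by (simp add: s_def v_def)
      from d(2)[OF this] have "\<bar>c * (s - L v)\<bar> \<le> e1 * \<bar>c\<bar> * norm (s, v)"
        using elim(1) zx by (simp add: F'_eq s_def v_def)
      then have *: "\<bar>s - L v\<bar> \<le> e1 * norm (s, v)"
        using ne by (simp add: abs_mult c_def)
      also have "\<dots> \<le> e1 * (\<bar>s\<bar> + norm v)"
        using nrm e1 by (intro mult_left_mono) auto
      finally have 1: "\<bar>s - L v\<bar> \<le> e1 * (\<bar>s\<bar> + norm v)" .
      \<comment> \<open>The size of \<open>s\<close> is controlled only by \<open>L v\<close> and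
        the very error being estimated, which therefore reappears on the right.\<close>
      have "\<bar>s\<bar> \<le> norm v * B + \<bar>s - L v\<bar>"
        using B(2)[of v] by simp
      then have 2: "\<bar>s\<bar> + norm v \<le> (norm v * B + norm v) + \<bar>s - L v\<bar>"
        by simp
      have "\<bar>s - L v\<bar> \<le> e1 * ((norm v * B + norm v) + \<bar>s - L v\<bar>)"
        using 1 mult_left_mono[OF 2, of e1] e1 by linarith
      moreover have "e1 * \<bar>s - L v\<bar> \<le> (1 / 2) * \<bar>s - L v\<bar>"
        using e1 by (intro mult_right_mono) auto
      ultimately have "\<bar>s - L v\<bar> \<le> 2 * e1 * (B + 1) * norm v"
        by (simp add: algebra_simps)
      also have "\<dots> \<le> e * norm v"
        using e1' by (intro mult_right_mono) auto
      finally show ?case by (simp add: s_def v_def)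
    qed
    then show "\<exists>d>0. \<forall>z. norm (z - x) < d \<longrightarrow> norm (y z - y x - L (z - x)) \<le> e * norm (z - x)"
      by (auto simp: eventually_nhds_metric dist_norm)
  qed
  then show ?thesis by (simp add: L_def[abs_def] c_def)
qed

section \<open>The collar radius\<close>

definition dominant :: "'n \<Rightarrow> real ^ 'n::finite \<Rightarrow> bool" where
  "dominant i0 d \<longleftrightarrow> (\<Sum>i\<in>UNIV - {i0}. sinh (d $ i / 2)) < sinh (d $ i0 / 2)"

lemma dominant_less:
  fixes d :: "real ^ 'n::finite"
  assumes n: "3 \<le> CARD('n)" and pos: "\<And>i. 0 < d $ i" and dom: "dominant i0 d" and ne: "i \<noteq> i0"
  shows "d $ i < d $ i0"
proof -
  have "sinh (d $ i / 2) < sinh (d $ i0 / 2)"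
    by (rule less_of_dominating[OF _ _ ne n])
      (use pos dom in \<open>simp_all add: dominant_def less_imp_le\<close>)
  then show ?thesis by simp
qed

lemma dominant_unique:
  fixes d :: "real ^ 'n::finite"
  assumes n: "3 \<le> CARD('n)" and pos: "\<And>i. 0 < d $ i" and dom: "dominant i0 d" "dominant i1 d"
  shows "i1 = i0"
proof (rule ccontr)
  assume ne: "i1 \<noteq> i0"
  show False
    using dominant_less[OF n pos dom(1) ne] dominant_less[OF n pos dom(2) ne[symmetric]] by simp
qed

lemma closing_zero_less:
  fixes d :: "real ^ 'n::finite"
  assumes n: "3 \<le> CARD('n)" and pos: "\<And>i. 0 < d $ i" and zero: "closing j i0 d = 0" and ne: "i \<noteq> i0"
  shows "d $ i < d $ i0"
proof -
  have "arsinh (sinh (d $ i / 2) / cosh j) < arsinh (sinh (d $ i0 / 2) / cosh j)"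
    by (rule less_of_dominating[OF _ _ ne n]) (use pos zero in \<open>simp_all add: closing_def\<close>)
  then show ?thesis by (simp add: divide_less_cancel)
qed

lemma EE_iff:
  "d \<in> EE \<longleftrightarrow> (\<forall>i. 0 < d $ i) \<and> (\<exists>i0. dominant i0 d \<and> d $ i0 \<le> (\<Sum>i\<in>UNIV - {i0}. d $ i))"
  by (simp add: EE_def dominant_def)

lemma EE_pos: "d \<in> EE \<Longrightarrow> 0 < d $ i"
  by (simp add: EE_def)

lemma EE_dominant_le:
  fixes d :: "real ^ 'n::{finite,linorder}"
  assumes "3 \<le> CARD('n)" "d \<in> EE" "dominant i0 d"
  shows "d $ i0 \<le> (\<Sum>i\<in>UNIV - {i0}. d $ i)"
proof -
  obtain i1 where "dominant i1 d" "d $ i1 \<le> (\<Sum>i\<in>UNIV - {i1}. d $ i)"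
    using assms(2) unfolding EE_iff by blast
  with dominant_unique[OF assms(1) EE_pos[OF assms(2)] assms(3)] show ?thesis by simp
qed

text \<open>Replaces the definite description by the closing equation. A competing polygon satisfies
  it for some index \<open>i1\<close>; as a zero of \<open>closing\<close> singles out the strictly
  longest side, \<open>i1 = i0\<close>, and uniqueness of the zero applies.\<close>

lemma collar_radius_eqI:
  fixes d :: "real ^ 'n::{finite,linorder}"
  assumes n: "3 \<le> CARD('n)" and pos: "\<And>i. 0 < d $ i" and j: "0 \<le> j" "closing j i0 d = 0"
  shows "collar_radius d = j"
  unfolding collar_radius_def
proof (rule the_equality)
  show "\<exists>x. equidistant_ngon CARD('n) j x \<and> side_lengths x = d"
    using j pos by (intro equidistant_ngon_of_closing)
next
  fix k assume "\<exists>x. equidistant_ngon CARD('n) k x \<and> side_lengths x = d"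
  then obtain x where x: "equidistant_ngon CARD('n) k x" "side_lengths x = d" by blast
  then obtain i1 where i1: "closing k i1 d = 0"
    using closing_of_equidistant_ngon by blast
  have "i1 = i0"
  proof (rule ccontr)
    assume ne: "i1 \<noteq> i0"
    show False
      using closing_zero_less[OF n pos j(2) ne] closing_zero_less[OF n pos i1 ne[symmetric]] by simp
  qed
  then show "k = j"
    using closing_eq_0_unique[OF n pos j] x(1) i1 by (simp add: equidistant_ngon_def)
qed

lemma collar_radius_closing:
  fixes d :: "real ^ 'n::{finite,linorder}"
  assumes n: "3 \<le> CARD('n)" and d: "d \<in> EE" "dominant i0 d"
  shows "0 \<le> collar_radius d" "closing (collar_radius d) i0 d = 0"
proof -
  obtain j where j: "0 \<le> j" "closing j i0 d = 0"
    using closing_has_zero[OF _ EE_dominant_le[OF n d]] d(2) unfolding dominant_def by blast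
  with collar_radius_eqI[OF n EE_pos[OF d(1)] j]
  show "0 \<le> collar_radius d" "closing (collar_radius d) i0 d = 0" by simp_all
qed

text \<open>Comparing the collar radius with a fixed \<open>k\<close> becomes a strict sign
  condition on \<open>closing k i0 d\<close>, which is continuous in \<open>d\<close>.\<close>

lemma less_collar_radius_iff:
  fixes d :: "real ^ 'n::{finite,linorder}"
  assumes "3 \<le> CARD('n)" "d \<in> EE" "dominant i0 d" "0 \<le> k"
  shows "k < collar_radius d \<longleftrightarrow> closing k i0 d < 0"
  using closing_less_0_iff[OF assms(1) EE_pos[OF assms(2)] collar_radius_closing[OF assms(1-3)] assms(4)]
  by simp

lemma collar_radius_less_iff:
  fixes d :: "real ^ 'n::{finite,linorder}"
  assumes "3 \<le> CARD('n)" "d \<in> EE" "dominant i0 d" "0 \<le> k"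
  shows "collar_radius d < k \<longleftrightarrow> 0 < closing k i0 d"
  using less_collar_radius_iff[OF assms] collar_radius_closing[OF assms(1-3)]
    closing_eq_0_unique[OF assms(1) EE_pos[OF assms(2)] collar_radius_closing[OF assms(1-3)] assms(4)]
  by (cases k "collar_radius d" rule: linorder_cases) force+

lemma collar_radius_eq_0_iff:
  fixes d :: "real ^ 'n::{finite,linorder}"
  assumes n: "3 \<le> CARD('n)" and d: "d \<in> EE"
  shows "collar_radius d = 0 \<longleftrightarrow> (\<exists>i0. d $ i0 = (\<Sum>i\<in>UNIV - {i0}. d $ i))"
proof
  assume 0: "collar_radius d = 0"
  obtain i0 where "dominant i0 d" using d by (auto simp: EE_iff)
  with collar_radius_closing(2)[OF n d] 0 show "\<exists>i0. d $ i0 = (\<Sum>i\<in>UNIV - {i0}. d $ i)"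
    by (auto simp: closing_0)
next
  assume "\<exists>i0. d $ i0 = (\<Sum>i\<in>UNIV - {i0}. d $ i)"
  then obtain i0 where "closing 0 i0 d = 0" by (auto simp: closing_0)
  then show "collar_radius d = 0"
    by (intro collar_radius_eqI[OF n EE_pos[OF d]]) auto
qed

section \<open>Symmetry\<close>

lemma sum_others_permute:
  fixes f :: "real \<Rightarrow> real" and d :: "real ^ 'n::finite"
  assumes "p permutes (UNIV :: 'n set)"
  shows "(\<Sum>i\<in>UNIV - {inv p i0}. f (d $ p i)) = (\<Sum>i\<in>UNIV - {i0}. f (d $ i))"
proof (rule sum.reindex_bij_betw[where h = p and g = "\<lambda>i. f (d $ i)"])
  have p: "inj p" "surj p" using assms by (auto simp: permutes_bij bij_is_inj bij_is_surj)
  then show "bij_betw p (UNIV - {inv p i0}) (UNIV - {i0})"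
    unfolding bij_betw_def image_set_diff[OF p(1)] by (auto intro: inj_on_subset simp: surj_f_inv_f)
qed

lemma collar_radius_permute:
  fixes d :: "real ^ 'n::{finite,linorder}"
  assumes n: "3 \<le> CARD('n)" and p: "p permutes UNIV" and d: "d \<in> EE"
  shows "(\<chi> i. d $ p i) \<in> EE" "collar_radius (\<chi> i. d $ p i) = collar_radius d"
proof -
  let ?e = "\<chi> i. d $ p i"
  obtain i0 where i0: "dominant i0 d" "d $ i0 \<le> (\<Sum>i\<in>UNIV - {i0}. d $ i)"
    using d by (auto simp: EE_iff)
  have pi: "p (inv p i0) = i0"
    using p by (simp add: permutes_inverses)
  \<comment> \<open>The side \<open>d $ i0\<close> stands at position \<open>inv p i0\<close> of the
    permuted vector.\<close>
  have "dominant (inv p i0) ?e"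
    using i0(1) sum_others_permute[OF p, of "\<lambda>u. sinh (u / 2)" d i0] by (simp add: dominant_def pi)
  moreover have "?e $ inv p i0 \<le> (\<Sum>i\<in>UNIV - {inv p i0}. ?e $ i)"
    using i0(2) sum_others_permute[OF p, of "\<lambda>u. u" d i0] by (simp add: pi)
  ultimately show e: "?e \<in> EE"
    using EE_pos[OF d] by (auto simp: EE_iff)
  have "closing j (inv p i0) ?e = closing j i0 d" for j
    using sum_others_permute[OF p, of "\<lambda>u. arsinh (sinh (u / 2) / cosh j)" d i0]
    by (simp add: closing_def pi)
  then have "closing (collar_radius d) (inv p i0) ?e = 0"
    using collar_radius_closing(2)[OF n d i0(1)] by simp
  then show "collar_radius ?e = collar_radius d"
    by (rule collar_radius_eqI[OF n EE_pos[OF e] collar_radius_closing(1)[OF n d i0(1)]])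
qed

section \<open>Continuity and divergence near \<open>HC\<close>\<close>

lemma tendsto_closing:
  "(X \<longlongrightarrow> d) F \<Longrightarrow> ((\<lambda>k. closing j i0 (X k)) \<longlongrightarrow> closing j i0 d) F"
  unfolding closing_def by (intro tendsto_intros) auto

lemma open_dominant: "open {d. dominant i0 d}"
  unfolding dominant_def by (intro open_Collect_less continuous_intros) simp_all

text \<open>Strict bounds on the collar radius at \<open>d\<close> are strict sign conditions at
  fixed radii, so they persist near \<open>d\<close>, as does the dominant index. No derivative is
  involved, so points of collar radius 0 are covered.\<close>

lemma continuous_on_collar_radius:
  assumes n: "3 \<le> CARD('n::{finite,linorder})"
  shows "continuous_on EE (collar_radius :: (real, 'n) vec \<Rightarrow> real)"
  unfolding continuous_on
proof
  fix d :: "(real, 'n) vec" assume d: "d \<in> EE"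
  obtain i0 where i0: "dominant i0 d" using d by (auto simp: EE_iff)
  have ev: "\<forall>\<^sub>F x in at d within EE. x \<in> EE \<and> dominant i0 x"
    using topological_tendstoD[OF tendsto_ident_at open_dominant, of d i0 EE] i0
    by (auto simp: eventually_at_filter elim: eventually_mono)
  have lim: "((\<lambda>x. closing j i0 x) \<longlongrightarrow> closing j i0 d) (at d within EE)" for j
    by (rule tendsto_closing) (rule tendsto_ident_at)
  show "(collar_radius \<longlongrightarrow> collar_radius d) (at d within EE)"
  proof (rule order_tendstoI)
    fix a assume a: "a < collar_radius d"
    show "\<forall>\<^sub>F x in at d within EE. a < collar_radius x"
    proof (cases "0 \<le> a")
      case True
      then have "closing a i0 d < 0"
        using less_collar_radius_iff[OF n d i0] a by simp
      from ev order_tendstoD(2)[OF lim this] show ?thesis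
        by eventually_elim (use less_collar_radius_iff[OF n] True in auto)
    next
      \<comment> \<open>The sign test applies to radii at least 0; a negative \<open>a\<close> lies
        below every collar radius.\<close>
      case False
      from ev show ?thesis
        by eventually_elim (use False collar_radius_closing(1)[OF n] in force)
    qed
  next
    fix a assume a: "collar_radius d < a"
    then have "0 \<le> a" using collar_radius_closing(1)[OF n d i0] by simp
    then have "0 < closing a i0 d"
      using collar_radius_less_iff[OF n d i0] a by simp
    from ev order_tendstoD(1)[OF lim this] show "\<forall>\<^sub>F x in at d within EE. collar_radius x < a"
      by eventually_elim (use collar_radius_less_iff[OF n] \<open>0 \<le> a\<close> in auto)
  qed
qed

text \<open>At a point of \<open>HC\<close> strict subadditivity of \<open>arsinh\<close> makes
  \<open>closing\<close> negative for every radius \<open>M\<close>; by continuity it stays negative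
  nearby, where the collar radius must then exceed \<open>M\<close>.\<close>

lemma collar_radius_at_top:
  fixes l :: "real ^ 'n::{finite,linorder}"
  assumes n: "3 \<le> CARD('n)" and X: "\<And>k. X k \<in> EE" and l: "l \<in> HC" and lim: "X \<longlonglongrightarrow> l"
  shows "filterlim (\<lambda>k. collar_radius (X k)) at_top sequentially"
proof -
  obtain i0 where pos: "\<And>i. 0 < l $ i"
    and i0: "sinh (l $ i0 / 2) = (\<Sum>i\<in>UNIV - {i0}. sinh (l $ i / 2))"
    using l by (auto simp: HC_def)
  have less: "l $ i < l $ i0" if "i \<noteq> i0" for i
  proof -
    have "sinh (l $ i / 2) < sinh (l $ i0 / 2)"
      by (rule less_of_dominating[OF _ _ that n]) (use pos i0 in simp_all)
    then show ?thesis by simp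
  qed
  \<comment> \<open>Openness of dominance cannot be used at \<open>l\<close>, where equality holds.
    Instead side \<open>i0\<close> stays strictly longest, and the dominant side of
    \<open>X k\<close> is its longest.\<close>
  have "\<forall>\<^sub>F k in sequentially. \<forall>i\<in>UNIV - {i0}. X k $ i < X k $ i0"
  proof (intro eventually_ball_finite ballI)
    fix i assume "i \<in> UNIV - {i0}"
    then have "0 < l $ i0 - l $ i" using less by simp
    moreover have "(\<lambda>k. X k $ i0 - X k $ i) \<longlonglongrightarrow> l $ i0 - l $ i"
      using lim by (intro tendsto_intros)
    ultimately have "\<forall>\<^sub>F k in sequentially. 0 < X k $ i0 - X k $ i"
      by (rule order_tendstoD(1)[rotated])
    then show "\<forall>\<^sub>F k in sequentially. X k $ i < X k $ i0"
      by eventually_elim simp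
  qed simp
  then have dom: "\<forall>\<^sub>F k in sequentially. dominant i0 (X k)"
  proof eventually_elim
    case (elim k)
    obtain i1 where i1: "dominant i1 (X k)" using X[of k] by (auto simp: EE_iff)
    have "i1 = i0"
    proof (rule ccontr)
      assume ne: "i1 \<noteq> i0"
      then have "X k $ i1 < X k $ i0" using elim by simp
      with dominant_less[OF n EE_pos[OF X[of k]] i1 ne[symmetric]] show False by simp
    qed
    with i1 show ?case by simp
  qed
  show ?thesis
    unfolding filterlim_at_top_ge[where c = 0]
  proof (intro allI impI)
    fix M :: real assume M: "0 \<le> M"
    have "arsinh (\<Sum>i\<in>UNIV - {i0}. sinh (l $ i / 2) / cosh M)
        < (\<Sum>i\<in>UNIV - {i0}. arsinh (sinh (l $ i / 2) / cosh M))"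
      using card_others[OF n] pos by (intro arsinh_sum_less) auto
    then have "closing M i0 l < 0"
      by (simp add: closing_def i0 sum_divide_distrib)
    from order_tendstoD(2)[OF tendsto_closing[OF lim] this] dom
    show "\<forall>\<^sub>F k in sequentially. M \<le> collar_radius (X k)"
      by eventually_elim (use less_collar_radius_iff[OF n X] M in \<open>auto intro: less_imp_le\<close>)
  qed
qed

section \<open>The interior of \<open>EE\<close>\<close>

definition inner_region :: "'n \<Rightarrow> (real ^ 'n::{finite,linorder}) set" where
  "inner_region i0 = {d. (\<forall>i. 0 < d $ i) \<and> dominant i0 d \<and> d $ i0 < (\<Sum>i\<in>UNIV - {i0}. d $ i)}"

lemma open_inner_region: "open (inner_region i0)"
proof -
  have "inner_region i0 = (\<Inter>i. {d. 0 < d $ i}) \<inter> {d. dominant i0 d} \<inter> {d. d $ i0 < (\<Sum>i\<in>UNIV - {i0}. d $ i)}"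
    by (auto simp: inner_region_def)
  then show ?thesis
    by (simp only:) (intro open_Int open_INT ballI finite open_dominant open_Collect_less continuous_intros)
qed

lemma inner_region_subset: "inner_region i0 \<subseteq> EE"
  using less_imp_le by (fastforce simp: inner_region_def EE_iff)

lemma inner_region_EE: "d \<in> inner_region i0 \<Longrightarrow> d \<in> EE"
  using inner_region_subset by blast

lemma inner_region_dominant: "d \<in> inner_region i0 \<Longrightarrow> dominant i0 d"
  by (simp add: inner_region_def)

text \<open>Lengthening the dominant side preserves dominance, so at an interior point the
  inequality between this side and the sum of the others has room to spare.\<close>

lemma interior_EE:
  assumes n: "3 \<le> CARD('n::{finite,linorder})"
  shows "interior EE = (\<Union>i0 :: 'n. inner_region i0)"
proof
  show "(\<Union>i0 :: 'n. inner_region i0) \<subseteq> interior EE"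
    by (intro interior_maximal UN_least inner_region_subset open_UN ballI open_inner_region)
  show "interior EE \<subseteq> (\<Union>i0 :: 'n. inner_region i0)"
  proof
    fix d :: "(real, 'n) vec" assume d: "d \<in> interior EE"
    then have dE: "d \<in> EE" using interior_subset by blast
    then obtain i0 where i0: "dominant i0 d" "d $ i0 \<le> (\<Sum>i\<in>UNIV - {i0}. d $ i)"
      by (auto simp: EE_iff)
    from d obtain e where e: "0 < e" "ball d e \<subseteq> EE"
      by (auto simp: mem_interior)
    define d' where "d' = d + (e / 2) *\<^sub>R axis i0 1"
    have comp: "d' $ i = d $ i + (if i = i0 then e / 2 else 0)" for i
      by (simp add: d'_def axis_def)
    have "dist d d' < e"
      using e(1) by (simp add: d'_def dist_norm)
    then have "d' \<in> EE" using e(2) by auto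
    moreover have "dominant i0 d'"
    proof -
      have "(\<Sum>i\<in>UNIV - {i0}. sinh (d' $ i / 2)) = (\<Sum>i\<in>UNIV - {i0}. sinh (d $ i / 2))"
        by (intro sum.cong) (auto simp: comp)
      also have "\<dots> < sinh (d $ i0 / 2)" using i0(1) by (simp add: dominant_def)
      also have "\<dots> < sinh (d' $ i0 / 2)" using e(1) by (simp add: comp)
      finally show ?thesis by (simp add: dominant_def)
    qed
    ultimately have "d' $ i0 \<le> (\<Sum>i\<in>UNIV - {i0}. d' $ i)"
      by (rule EE_dominant_le[OF n])
    also have "\<dots> = (\<Sum>i\<in>UNIV - {i0}. d $ i)"
      by (intro sum.cong) (auto simp: comp)
    finally have "d $ i0 < (\<Sum>i\<in>UNIV - {i0}. d $ i)"
      using e(1) by (simp add: comp)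
    then show "d \<in> (\<Union>i0. inner_region i0)"
      using dE i0(1) by (auto simp: inner_region_def EE_iff)
  qed
qed

section \<open>The derivative of the closing equation\<close>

text \<open>Written with \<open>powr\<close> so that \<open>Ck_on_powr\<close> applies.\<close>

definition inv_hyp :: "'n \<Rightarrow> real \<Rightarrow> real ^ 'n::finite \<Rightarrow> real" where
  "inv_hyp i j d = ((cosh j)\<^sup>2 + (sinh (d $ i / 2))\<^sup>2) powr (- 1 / 2)"

lemma hyp_pos: "0 < (cosh j)\<^sup>2 + (sinh y)\<^sup>2" for j y :: real
  by (intro add_pos_nonneg) auto

lemma inv_hyp_eq: "inv_hyp i j d = 1 / sqrt ((cosh j)\<^sup>2 + (sinh (d $ i / 2))\<^sup>2)"
  using hyp_pos[of j "d $ i / 2"] by (simp add: inv_hyp_def powr_minus_divide powr_half_sqrt)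

text \<open>The left side is the derivative of \<open>arsinh\<close> at the argument that occurs in
  \<open>closing\<close>.\<close>

lemma inv_hyp_rescale:
  "1 / sqrt ((sinh (d $ i / 2) / cosh j)\<^sup>2 + 1) = cosh j * inv_hyp i j d"
proof -
  have "(sinh (d $ i / 2) / cosh j)\<^sup>2 + 1 = ((cosh j)\<^sup>2 + (sinh (d $ i / 2))\<^sup>2) / (cosh j)\<^sup>2"
    by (simp add: field_simps)
  then have "sqrt ((sinh (d $ i / 2) / cosh j)\<^sup>2 + 1) = sqrt ((cosh j)\<^sup>2 + (sinh (d $ i / 2))\<^sup>2) / cosh j"
    by (simp add: real_sqrt_divide)
  then show ?thesis by (simp add: inv_hyp_eq)
qed

lemma has_derivative_closing_term:
  fixes d :: "real ^ 'n::finite"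
  shows "((\<lambda>p. arsinh (sinh (snd p $ i / 2) / cosh (fst p))) has_derivative
    (\<lambda>q. cosh (d $ i / 2) / 2 * inv_hyp i j d * snd q $ i
       - sinh (d $ i / 2) * inv_hyp i j d * tanh j * fst q)) (at (j, d))"
proof -
  let ?a = "sinh (d $ i / 2)"
  have g: "((\<lambda>p. sinh (snd p $ i / 2) / cosh (fst p)) has_derivative
     (\<lambda>q. (cosh (d $ i / 2) / 2 * snd q $ i * cosh j - ?a * (sinh j * fst q)) / (cosh j * cosh j))) (at (j, d))"
  proof (rule has_derivative_eq_rhs)
    have "((\<lambda>p. snd p $ i / 2) has_derivative (\<lambda>q. snd q $ i / 2)) (at (j, d))"
      by (intro bounded_linear_imp_has_derivative bounded_linear_compose[OF bounded_linear_divide]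
          bounded_linear_compose[OF bounded_linear_vec_nth bounded_linear_snd])
    then have s: "((\<lambda>p. sinh (snd p $ i / 2)) has_derivative (\<lambda>q. snd q $ i / 2 * cosh (d $ i / 2))) (at (j, d))"
      by (rule DERIV_compose_FDERIV[rotated])
        (use has_field_derivative_sinh[OF DERIV_ident, of "d $ i / 2"] in simp)
    have c: "((\<lambda>p. cosh (fst p)) has_derivative (\<lambda>q. fst q * sinh j)) (at (j, d))"
      by (rule DERIV_compose_FDERIV[OF _ bounded_linear_imp_has_derivative[OF bounded_linear_fst]])
        (use has_field_derivative_cosh[OF DERIV_ident, of j] in simp)
    show "((\<lambda>p. sinh (snd p $ i / 2) / cosh (fst p)) has_derivative
        (\<lambda>q. (snd q $ i / 2 * cosh (d $ i / 2) * cosh (fst (j, d)) - sinh (snd (j, d) $ i / 2) * (fst q * sinh j))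
          / (cosh (fst (j, d)) * cosh (fst (j, d))))) (at (j, d))"
      by (rule has_derivative_divide'[OF s c]) simp
  qed (simp add: fun_eq_iff)
  have "((\<lambda>p. arsinh (sinh (snd p $ i / 2) / cosh (fst p))) has_derivative
     (\<lambda>q. (cosh (d $ i / 2) / 2 * snd q $ i * cosh j - ?a * (sinh j * fst q)) / (cosh j * cosh j)
        * (1 / sqrt ((?a / cosh j)\<^sup>2 + 1)))) (at (j, d))"
    by (rule DERIV_compose_FDERIV[OF _ g]) (use arsinh_real_has_field_derivative[of "?a / cosh j"] in simp)
  then show ?thesis
    unfolding inv_hyp_rescale by (rule has_derivative_eq_rhs) (simp add: fun_eq_iff tanh_def field_simps)
qed

text \<open>Up to the factor \<open>tanh j\<close> the derivative of \<open>closing\<close> in its first argument.\<close>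

definition slope_gap :: "'n \<Rightarrow> real \<Rightarrow> real ^ 'n::finite \<Rightarrow> real" where
  "slope_gap i0 j d = (\<Sum>i\<in>UNIV - {i0}. sinh (d $ i / 2) * inv_hyp i j d) - sinh (d $ i0 / 2) * inv_hyp i0 j d"

lemma has_derivative_closing:
  fixes d :: "real ^ 'n::finite"
  shows "((\<lambda>p. closing (fst p) i0 (snd p)) has_derivative
    (\<lambda>q. cosh (d $ i0 / 2) / 2 * inv_hyp i0 j d * snd q $ i0
       - (\<Sum>i\<in>UNIV - {i0}. cosh (d $ i / 2) / 2 * inv_hyp i j d * snd q $ i)
       + tanh j * slope_gap i0 j d * fst q)) (at (j, d))"
  unfolding closing_def
  by (rule has_derivative_eq_rhs[OF has_derivative_diff[OF has_derivative_closing_term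
        has_derivative_sum[OF has_derivative_closing_term]]])
    (simp add: fun_eq_iff slope_gap_def sum_subtractf sum_distrib_left sum_distrib_right algebra_simps)

text \<open>\<open>sinh (d $ i / 2) * inv_hyp i j d\<close> is the hyperbolic tangent of half the
  foot distance \<open>l i\<close>. The \<open>l i\<close> add up to \<open>l i0\<close> at a zero
  of \<open>closing\<close>, so the gap is the defect in the strict subadditivity of
  \<open>tanh\<close>.\<close>

lemma slope_gap_pos:
  fixes d :: "real ^ 'n::finite"
  assumes n: "3 \<le> CARD('n)" and pos: "\<And>i. 0 < d $ i" and zero: "closing j i0 d = 0"
  shows "0 < slope_gap i0 j d"
proof -
  define l where "l i = arsinh (sinh (d $ i / 2) / cosh j)" for i
  have tanh_l: "tanh (l i) = sinh (d $ i / 2) * inv_hyp i j d" for i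
  proof -
    have "tanh (l i) = sinh (d $ i / 2) / cosh j * (1 / sqrt ((sinh (d $ i / 2) / cosh j)\<^sup>2 + 1))"
      unfolding l_def tanh_def sinh_arsinh_real cosh_arsinh_real by simp
    then show ?thesis unfolding inv_hyp_rescale by simp
  qed
  have "tanh (l i0) < (\<Sum>i\<in>UNIV - {i0}. tanh (l i))"
  proof -
    have "l i0 = (\<Sum>i\<in>UNIV - {i0}. l i)"
      using zero by (simp add: closing_def l_def)
    moreover have "tanh (\<Sum>i\<in>UNIV - {i0}. l i) < (\<Sum>i\<in>UNIV - {i0}. tanh (l i))"
      using card_others[OF n] pos by (intro tanh_sum_less) (simp_all add: l_def)
    ultimately show ?thesis by (simp only:)
  qed
  then show ?thesis
    unfolding tanh_l by (simp add: slope_gap_def)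
qed

lemma collar_radius_pos:
  fixes d :: "real ^ 'n::{finite,linorder}"
  assumes n: "3 \<le> CARD('n)" and d: "d \<in> inner_region i0"
  shows "0 < collar_radius d"
proof -
  have "closing 0 i0 d < 0"
    using d by (simp add: closing_0 inner_region_def)
  then show ?thesis
    using less_collar_radius_iff[OF n inner_region_EE[OF d] inner_region_dominant[OF d], of 0] by simp
qed

text \<open>The implicit derivative divides by \<open>tanh j * slope_gap i0 j d\<close>; the first
  factor is nonzero because the collar radius is positive on \<open>inner_region i0\<close>.\<close>

lemma collar_radius_has_derivative:
  fixes d :: "real ^ 'n::{finite,linorder}"
  assumes n: "3 \<le> CARD('n)" and d: "d \<in> inner_region i0"
  defines "j \<equiv> collar_radius d"
  shows "(collar_radius has_derivative
    (\<lambda>v. ((\<Sum>i\<in>UNIV - {i0}. cosh (d $ i / 2) / 2 * inv_hyp i j d * v $ i)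
          - cosh (d $ i0 / 2) / 2 * inv_hyp i0 j d * v $ i0) / (tanh j * slope_gap i0 j d))) (at d)"
proof -
  have dE: "d \<in> EE" and dom: "dominant i0 d"
    using inner_region_EE[OF d] inner_region_dominant[OF d] by simp_all
  have ev: "\<forall>\<^sub>F x in nhds d. x \<in> inner_region i0"
    using open_inner_region d by (rule eventually_nhds_in_open)
  have "continuous_on (inner_region i0) collar_radius"
    using continuous_on_collar_radius[OF n] inner_region_subset by (rule continuous_on_subset)
  then have cont: "isCont collar_radius d"
    using d by (simp add: continuous_on_eq_continuous_at[OF open_inner_region])
  have zero: "\<forall>\<^sub>F x in nhds d. closing (fst (collar_radius x, x)) i0 (snd (collar_radius x, x)) = 0"
    using ev
  proof eventually_elim
    case (elim x)
    then show ?case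
      by (simp add: collar_radius_closing[OF n] inner_region_EE inner_region_dominant)
  qed
  have "0 < slope_gap i0 j d"
    unfolding j_def by (intro slope_gap_pos[OF n EE_pos[OF dE]] collar_radius_closing[OF n dE dom])
  moreover have "0 < j"
    unfolding j_def by (rule collar_radius_pos[OF n d])
  ultimately have ne: "tanh j * slope_gap i0 j d \<noteq> 0" by simp
  define F' where "F' = (\<lambda>q. cosh (d $ i0 / 2) / 2 * inv_hyp i0 j d * snd q $ i0
       - (\<Sum>i\<in>UNIV - {i0}. cosh (d $ i / 2) / 2 * inv_hyp i j d * snd q $ i)
       + tanh j * slope_gap i0 j d * fst q)"
  have F': "((\<lambda>p. closing (fst p) i0 (snd p)) has_derivative F') (at (collar_radius d, d))"
    unfolding F'_def j_def by (rule has_derivative_closing)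
  have 1: "F' (1, 0) = tanh j * slope_gap i0 j d"
    by (simp add: F'_def)
  have 2: "- F' (0, v) = (\<Sum>i\<in>UNIV - {i0}. cosh (d $ i / 2) / 2 * inv_hyp i j d * v $ i)
          - cosh (d $ i0 / 2) / 2 * inv_hyp i0 j d * v $ i0" for v
    by (simp add: F'_def)
  show ?thesis
    using has_derivative_implicit[OF F' cont zero] ne unfolding 1 2 by blast
qed

section \<open>Smoothness and the partial derivatives\<close>

lemma Ck_on_collar_radius:
  assumes n: "3 \<le> CARD('n::{finite,linorder})"
  shows "Ck_on k (inner_region (i0 :: 'n)) collar_radius"
proof (induction k)
  case 0
  show ?case
    using continuous_on_subset[OF continuous_on_collar_radius[OF n] inner_region_subset] by simp
next
  case (Suc k)
  let ?S = "inner_region i0" and ?J = "collar_radius :: (real, 'n) vec \<Rightarrow> real"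
  note S = open_inner_region[of i0]
  have coord: "Ck_on k ?S (\<lambda>d. d $ i / 2)" for i
    by (rule Ck_on_bounded_linear[OF S])
      (rule bounded_linear_compose[OF bounded_linear_divide bounded_linear_vec_nth])
  have inv_hyp: "Ck_on k ?S (\<lambda>d. inv_hyp i (?J d) d)" for i
    unfolding inv_hyp_def power2_eq_square
    by (intro Ck_on_powr[OF S] Ck_on_add[OF S] Ck_on_mult[OF S] Ck_on_cosh[OF S] Ck_on_sinh[OF S] coord Suc.IH)
      (rule hyp_pos [unfolded power2_eq_square])
  have gap: "Ck_on k ?S (\<lambda>d. slope_gap i0 (?J d) d)"
  proof -
    have "Ck_on k ?S (\<lambda>d. (\<Sum>i\<in>UNIV - {i0}. sinh (d $ i / 2) * inv_hyp i (?J d) d)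
        + (- 1) * (sinh (d $ i0 / 2) * inv_hyp i0 (?J d) d))"
      by (intro Ck_on_add[OF S] Ck_on_sum[OF S] Ck_on_mult[OF S] Ck_on_const[OF S] Ck_on_sinh[OF S] coord inv_hyp) simp
    then show ?thesis by (simp add: slope_gap_def)
  qed
  show ?case
  proof (rule Ck_on_SucI[OF S collar_radius_has_derivative[OF n]])
    fix v :: "(real, 'n) vec"
    \<comment> \<open>Division by \<open>tanh\<close> is rewritten as multiplication by
      \<open>cosh\<close> and by the power \<open>- 1\<close> of the positive quantity
      \<open>?D\<close>, a form that the closure rules for \<open>Ck_on\<close> cover.\<close>
    let ?N = "\<lambda>d. (\<Sum>i\<in>UNIV - {i0}. cosh (d $ i / 2) * inv_hyp i (?J d) d * (v $ i / 2))
        + cosh (d $ i0 / 2) * inv_hyp i0 (?J d) d * (- v $ i0 / 2)"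
    let ?D = "\<lambda>d. sinh (?J d) * slope_gap i0 (?J d) d"
    have pos: "0 < ?D d" if "d \<in> ?S" for d
    proof -
      note dE = inner_region_EE[OF that]
      have "0 < slope_gap i0 (?J d) d"
        by (rule slope_gap_pos[OF n EE_pos[OF dE] collar_radius_closing(2)[OF n dE inner_region_dominant[OF that]]])
      then show ?thesis
        using collar_radius_pos[OF n that] by simp
    qed
    have "Ck_on k ?S (\<lambda>d. ?N d * cosh (?J d) * ?D d powr - 1)"
      by (intro Ck_on_add[OF S] Ck_on_sum[OF S] Ck_on_mult[OF S] Ck_on_const[OF S] Ck_on_cosh[OF S]
          Ck_on_sinh[OF S] Ck_on_powr[OF S] coord inv_hyp gap Suc.IH pos) simp_all
    then show "Ck_on k ?S (\<lambda>d. ((\<Sum>i\<in>UNIV - {i0}. cosh (d $ i / 2) / 2 * inv_hyp i (?J d) d * v $ i)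
          - cosh (d $ i0 / 2) / 2 * inv_hyp i0 (?J d) d * v $ i0) / (tanh (?J d) * slope_gap i0 (?J d) d))"
    proof (rule Ck_on_cong[OF S, rotated])
      fix d assume "d \<in> ?S"
      with pos have "0 < ?D d" by blast
      then have "?D d powr - 1 = 1 / ?D d" by (simp add: powr_minus_divide)
      then show "?N d * cosh (?J d) * ?D d powr - 1 =
          ((\<Sum>i\<in>UNIV - {i0}. cosh (d $ i / 2) / 2 * inv_hyp i (?J d) d * v $ i)
          - cosh (d $ i0 / 2) / 2 * inv_hyp i0 (?J d) d * v $ i0) / (tanh (?J d) * slope_gap i0 (?J d) d)"
        by (simp add: tanh_def mult_ac)
    qed
  qed
qed

lemma smooth_on_collar_radius:
  assumes n: "3 \<le> CARD('n::{finite,linorder})"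
  shows "smooth_on (interior EE) (collar_radius :: (real, 'n) vec \<Rightarrow> real)"
  unfolding smooth_on_def interior_EE[OF n]
  by (intro allI Ck_on_Union) (auto simp: open_inner_region Ck_on_collar_radius[OF n])

text \<open>The implicit derivative is expanded by \<open>- r\<close>, where \<open>r\<close> is the
  square root belonging to the longest side. This turns each \<open>inv_hyp\<close> into a square
  root of a quotient and \<open>slope_gap\<close> into the displayed denominator, which is therefore
  negative.\<close>

lemma collar_radius_partial_derivative:
  fixes d :: "real ^ 'n::{finite,linorder}"
  assumes n: "3 \<le> CARD('n)" and d: "d \<in> interior EE" and i0: "\<forall>i. d $ i \<le> d $ i0"
  defines "j \<equiv> collar_radius d"
  shows "((\<lambda>t. collar_radius (d + t *\<^sub>R axis i 1)) has_real_derivative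
        1 / 2 *
          ((if i = i0 then 1 else - 1) * cosh (d $ i / 2) * coth j *
             sqrt (((cosh j)\<^sup>2 + (sinh (d $ i0 / 2))\<^sup>2) /
                   ((cosh j)\<^sup>2 + (sinh (d $ i / 2))\<^sup>2))) /
          (sinh (d $ i0 / 2) -
            (\<Sum>k\<in>UNIV - {i0}. sinh (d $ k / 2) *
               sqrt (((cosh j)\<^sup>2 + (sinh (d $ i0 / 2))\<^sup>2) /
                     ((cosh j)\<^sup>2 + (sinh (d $ k / 2))\<^sup>2))))) (at 0)"
    (is "(_ has_real_derivative ?R) _")
proof -
  obtain i1 where i1: "d \<in> inner_region i1"
    using d interior_EE[OF n] by auto
  \<comment> \<open>The given side is maximal, that of the region dominant; a dominant side is
    strictly longest, so the two agree.\<close>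
  have "i1 = i0"
  proof (rule ccontr)
    assume "i1 \<noteq> i0"
    then have "d $ i0 < d $ i1"
      using i1 by (intro dominant_less[OF n]) (auto simp: inner_region_def)
    with i0[rule_format, of i1] show False by simp
  qed
  with i1 have dS: "d \<in> inner_region i0" by simp
  define r where "r = sqrt ((cosh j)\<^sup>2 + (sinh (d $ i0 / 2))\<^sup>2)"
  have r: "0 < r" using hyp_pos by (simp add: r_def)
  have sq: "sqrt (((cosh j)\<^sup>2 + (sinh (d $ i0 / 2))\<^sup>2) / ((cosh j)\<^sup>2 + (sinh (d $ k / 2))\<^sup>2))
      = r * inv_hyp k j d" for k
    by (simp add: r_def inv_hyp_eq real_sqrt_divide)
  have r0: "r * inv_hyp i0 j d = 1"
    using r by (simp add: r_def inv_hyp_eq)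
  let ?J' = "\<lambda>v. ((\<Sum>k\<in>UNIV - {i0}. cosh (d $ k / 2) / 2 * inv_hyp k j d * v $ k)
          - cosh (d $ i0 / 2) / 2 * inv_hyp i0 j d * v $ i0) / (tanh j * slope_gap i0 j d)"
  have "((\<lambda>t. d + t *\<^sub>R axis i 1) has_derivative (\<lambda>t. t *\<^sub>R axis i 1)) (at 0)"
    by (auto intro!: derivative_eq_intros)
  moreover have "(collar_radius has_derivative ?J') (at (d + 0 *\<^sub>R axis i 1))"
    using collar_radius_has_derivative[OF n dS] by (simp add: j_def)
  ultimately have "((\<lambda>t. collar_radius (d + t *\<^sub>R axis i 1)) has_derivative (\<lambda>t. ?J' (t *\<^sub>R axis i 1))) (at 0)"
    by (rule has_derivative_compose)
  moreover have "?J' (t *\<^sub>R axis i 1) = ?R * t" for t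
  proof -
    let ?s = "if i = i0 then 1 else - 1 :: real"
    have "(\<Sum>k\<in>UNIV - {i0}. cosh (d $ k / 2) / 2 * inv_hyp k j d * (t *\<^sub>R axis i 1 :: (real, 'n) vec) $ k)
        = (if i = i0 then 0 else cosh (d $ i / 2) / 2 * inv_hyp i j d * t)"
      by (simp add: axis_def if_distrib cong: if_cong)
    then have "?J' (t *\<^sub>R axis i 1) =
        - (?s * (cosh (d $ i / 2) / 2 * inv_hyp i j d * t)) / (tanh j * slope_gap i0 j d)"
      by (simp add: axis_def)
    also have "\<dots> = (1 / 2 * (?s * cosh (d $ i / 2) * coth j * (r * inv_hyp i j d))) / (- (r * slope_gap i0 j d)) * t"
      using r by (simp add: tanh_def coth_def)
    also have "- (r * slope_gap i0 j d) =
        sinh (d $ i0 / 2) - (\<Sum>k\<in>UNIV - {i0}. sinh (d $ k / 2) * (r * inv_hyp k j d))"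
    proof -
      have "r * (sinh (d $ i0 / 2) * inv_hyp i0 j d) = sinh (d $ i0 / 2)"
        using r0 by (metis mult.left_commute mult.right_neutral)
      then show ?thesis
        by (simp add: slope_gap_def right_diff_distrib sum_distrib_left mult.left_commute)
    qed
    finally show ?thesis unfolding sq by simp
  qed
  then have "(\<lambda>t. ?J' (t *\<^sub>R axis i 1)) = (*) ?R"
    by (rule ext)
  ultimately show ?thesis
    unfolding has_field_derivative_def by (simp only:)
qed

theorem proposition4p7:
  fixes J :: "real ^ 'n::{finite,linorder} \<Rightarrow> real"
  defines "J \<equiv> collar_radius"
  assumes "CARD('n) \<ge> 3"
  shows "(\<forall>d\<in>EE. 0 \<le> J d) \<and>
    (\<forall>p. p permutes UNIV \<longrightarrow> (\<forall>d\<in>EE. (\<chi> i. d $ p i) \<in> EE \<and> J (\<chi> i. d $ p i) = J d)) \<and>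
    continuous_on EE J \<and>
    smooth_on (interior EE) J \<and>
    (\<forall>d\<in>interior EE. \<forall>i0. (\<forall>i. d $ i \<le> d $ i0) \<longrightarrow>
      (\<forall>i. ((\<lambda>t. J (d + t *\<^sub>R axis i 1)) has_real_derivative
        1 / 2 *
          ((if i = i0 then 1 else - 1) * cosh (d $ i / 2) * coth (J d) *
             sqrt (((cosh (J d))\<^sup>2 + (sinh (d $ i0 / 2))\<^sup>2) /
                   ((cosh (J d))\<^sup>2 + (sinh (d $ i / 2))\<^sup>2))) /
          (sinh (d $ i0 / 2) -
            (\<Sum>j\<in>UNIV - {i0}. sinh (d $ j / 2) *
               sqrt (((cosh (J d))\<^sup>2 + (sinh (d $ i0 / 2))\<^sup>2) /
                     ((cosh (J d))\<^sup>2 + (sinh (d $ j / 2))\<^sup>2))))) (at 0))) \<and>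
    (\<forall>X l. (\<forall>k. X k \<in> EE) \<and> l \<in> HC \<and> X \<longlonglongrightarrow> l \<longrightarrow>
      filterlim (\<lambda>k. J (X k)) at_top sequentially) \<and>
    (\<forall>d\<in>EE. J d = 0 \<longleftrightarrow> (\<exists>i0. d $ i0 = (\<Sum>i\<in>UNIV - {i0}. d $ i)))"
proof -
  note n = assms(2)
  have nonneg: "\<forall>d\<in>EE. 0 \<le> J d"
  proof
    fix d :: "(real, 'n) vec" assume d: "d \<in> EE"
    then obtain i0 where "dominant i0 d" unfolding EE_iff by blast
    then show "0 \<le> J d" unfolding J_def by (rule collar_radius_closing(1)[OF n d])
  qed
  show ?thesis
    using nonneg collar_radius_permute[OF n] continuous_on_collar_radius[OF n] smooth_on_collar_radius[OF n]
      collar_radius_partial_derivative[OF n] collar_radius_at_top[OF n] collar_radius_eq_0_iff[OF n]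
    unfolding J_def by (intro conjI allI ballI impI) auto
qed

end
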